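(* Let $F$ be a field of characteristic $2$. A left-linked set of quadratic $n$-fold Pfister forms over $F$ is strongly tight. Moreover, if $S$ is left-linked then there are a bilinear $(n-1)$-fold Pfister form $b$ and elements $\alpha_1,\dots,\alpha_s\in F$ such that the elements of the group generated by $S$ in $I_q^nF$ are the Pfister forms $b\otimes\langle\langle\alpha_{i_1}+\cdots+\alpha_{i_k}]]$ for the subsets $\{i_1,\dots,i_k\}\subseteq\{1,\dots,s\}$.
   Context: $[a,b]$ denotes the quadratic form $ax^2+xy+by^2$. $I_q^1F$ is the group of Witt classes of even-dimensional nonsingular quadratic forms over $F$ under orthogonal sum; forms are identified with their Witt classes. Bilinear Pfister forms: $\langle\langle\beta\rangle\rangle=\langle 1,\beta\rangle$ (diagonal symmetric bilinear form) and $\langle\langle\beta_1,\dots,\beta_m\rangle\rangle=\langle\langle\beta_1\rangle\rangle\otimes\cdots\otimes\langle\langle\beta_m\rangle\rangle$, $\beta_i\in F^\times$ (the $0$-fold one is $\langle 1\rangle$). Quadratic Pfister forms: $\langle\langle\alpha]]=[1,\alpha]$ and $\langle\langle\beta_1,\dots,\beta_{n-1},\alpha]]=\langle\langle\beta_1,\dots,\beta_{n-1}\rangle\rangle\otimes\langle\langle\alpha]]$. $I_q^nF$ is the subgroup of $I_q^1F$ generated by scalar multiples of quadratic $n$-fold Pfister forms. A set of quadratic $n$-fold Pfister forms is left-linked if there is a bilinear $(n-1)$-fold Pfister form $b$ such that every form in the set is isometric to $b\otimes\langle\langle\alpha]]$ for some $\alpha\in F$. It is strongly tight if the subgroup it generates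 in $I_q^nF$ consists of (Witt classes of) quadratic $n$-fold Pfister forms. The empty sum is $0$.
   Formalization: The second claim is proved for S with finitely many Witt classes; otherwise no finite list α_1,…,α_s can exist, as for S = all forms [1,α] with n = 1 and F/{x²+x} infinite. *)

theory Defs
  imports "Jordan_Normal_Form.Matrix" "HOL-Algebra.Generated_Groups"
    "HOL-Computational_Algebra.Computational_Algebra"
begin

section \<open>Quadratic forms\<close>

text \<open>
  Every finite-dimensional quadratic space is isometric to one on some \<open>F\<^sup>n\<close>, so a quadratic
  form is given by its dimension and a quadratic map on \<open>carrier_vec n\<close>. The values of the map
  outside \<open>carrier_vec n\<close> carry no meaning: all notions below are insensitive to them.
\<close>

datatype 'a qform = QForm (qdim: nat) (qval: "'a vec \<Rightarrow> 'a")

definition polar :: "'a::field qform \<Rightarrow> 'a vec \<Rightarrow> 'a vec \<Rightarrow> 'a" where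
  "polar \<phi> v w = qval \<phi> (v + w) - qval \<phi> v - qval \<phi> w"

text \<open>Linearity of the polar form in the second argument follows from its symmetry.\<close>

definition quadratic_form :: "'a::field qform \<Rightarrow> bool" where
  "quadratic_form \<phi> \<longleftrightarrow>
     (\<forall>c. \<forall>v \<in> carrier_vec (qdim \<phi>). qval \<phi> (c \<cdot>\<^sub>v v) = c\<^sup>2 * qval \<phi> v) \<and>
     (\<forall>u \<in> carrier_vec (qdim \<phi>). \<forall>v \<in> carrier_vec (qdim \<phi>). \<forall>w \<in> carrier_vec (qdim \<phi>).
        polar \<phi> (u + v) w = polar \<phi> u w + polar \<phi> v w) \<and>
     (\<forall>c. \<forall>v \<in> carrier_vec (qdim \<phi>). \<forall>w \<in> carrier_vec (qdim \<phi>).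
        polar \<phi> (c \<cdot>\<^sub>v v) w = c * polar \<phi> v w)"

definition nonsingular :: "'a::field qform \<Rightarrow> bool" where
  "nonsingular \<phi> \<longleftrightarrow>
     (\<forall>v \<in> carrier_vec (qdim \<phi>).
        (\<forall>w \<in> carrier_vec (qdim \<phi>). polar \<phi> v w = 0) \<longrightarrow> v = 0\<^sub>v (qdim \<phi>))"

definition isometric :: "'a::field qform \<Rightarrow> 'a qform \<Rightarrow> bool" where
  "isometric \<phi> \<psi> \<longleftrightarrow>
     qdim \<phi> = qdim \<psi> \<and>
     (\<exists>P \<in> carrier_mat (qdim \<phi>) (qdim \<phi>). invertible_mat P \<and>
        (\<forall>v \<in> carrier_vec (qdim \<phi>). qval \<psi> (P *\<^sub>v v) = qval \<phi> v))"

definition orth_sum :: "'a::field qform \<Rightarrow> 'a qform \<Rightarrow> 'a qform" where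
  "orth_sum \<phi> \<psi> =
     QForm (qdim \<phi> + qdim \<psi>)
       (\<lambda>v. qval \<phi> (vec_first v (qdim \<phi>)) + qval \<psi> (vec_last v (qdim \<psi>)))"

definition zero_form :: "'a::field qform" where
  "zero_form = QForm 0 (\<lambda>_. 0)"

definition scale_form :: "'a::field \<Rightarrow> 'a qform \<Rightarrow> 'a qform" where
  "scale_form c \<phi> = QForm (qdim \<phi>) (\<lambda>v. c * qval \<phi> v)"

text \<open>The form \<open>[a, b] = ax\<^sup>2 + xy + by\<^sup>2\<close>.\<close>

definition binary_form :: "'a::field \<Rightarrow> 'a \<Rightarrow> 'a qform" where
  "binary_form a b = QForm 2 (\<lambda>v. a * (v $ 0)\<^sup>2 + (v $ 0) * (v $ 1) + b * (v $ 1)\<^sup>2)"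


section \<open>Witt classes\<close>

fun hyperbolic :: "nat \<Rightarrow> 'a::field qform" where
  "hyperbolic 0 = zero_form"
| "hyperbolic (Suc k) = orth_sum (binary_form 0 0) (hyperbolic k)"

definition witt_equiv :: "'a::field qform \<Rightarrow> 'a qform \<Rightarrow> bool" where
  "witt_equiv \<phi> \<psi> \<longleftrightarrow>
     (\<exists>i j. isometric (orth_sum \<phi> (hyperbolic i)) (orth_sum \<psi> (hyperbolic j)))"

definition even_nonsingular :: "'a::field qform set" where
  "even_nonsingular = {\<phi>. quadratic_form \<phi> \<and> nonsingular \<phi> \<and> even (qdim \<phi>)}"

definition witt_class :: "'a::field qform \<Rightarrow> 'a qform set" where
  "witt_class \<phi> = {\<psi> \<in> even_nonsingular. witt_equiv \<phi> \<psi>}"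

text \<open>The group \<open>I\<^sub>q\<^sup>1 F\<close>, written multiplicatively as usual for monoid records.\<close>

definition Iq1 :: "'a::field qform set monoid" where
  "Iq1 = \<lparr>carrier = witt_class ` even_nonsingular,
          mult = (\<lambda>X Y. \<Union>\<phi>\<in>X. \<Union>\<psi>\<in>Y. witt_class (orth_sum \<phi> \<psi>)),
          one = witt_class zero_form\<rparr>"


section \<open>Bilinear forms and Pfister forms\<close>

text \<open>
  A symmetric bilinear form on \<open>F\<^sup>m\<close> is given by its Gram matrix. The standard basis of
  \<open>F\<^sup>m \<otimes> F\<^sup>n\<close> is ordered lexicographically: \<open>e\<^sub>i \<otimes> e\<^sub>k\<close> has index \<open>i * n + k\<close>.
\<close>

definition bil_isometric :: "'a::field mat \<Rightarrow> 'a mat \<Rightarrow> bool" where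
  "bil_isometric B C \<longleftrightarrow>
     (\<exists>m. B \<in> carrier_mat m m \<and> C \<in> carrier_mat m m \<and>
        (\<exists>P \<in> carrier_mat m m. invertible_mat P \<and> B = transpose_mat P * C * P))"

definition bil_tensor :: "'a::field mat \<Rightarrow> 'a mat \<Rightarrow> 'a mat" where
  "bil_tensor B C =
     mat (dim_row B * dim_row C) (dim_col B * dim_col C)
       (\<lambda>(i, j). B $$ (i div dim_row C, j div dim_col C) * C $$ (i mod dim_row C, j mod dim_col C))"

definition block :: "nat \<Rightarrow> 'a vec \<Rightarrow> nat \<Rightarrow> 'a vec" where
  "block n v i = vec n (\<lambda>k. v $ (i * n + k))"

text \<open>
  The product \<open>b \<otimes> \<phi>\<close> is the quadratic form with \<open>(b \<otimes> \<phi>)(x \<otimes> v) = b(x, x) \<phi>(v)\<close> whose polar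
  form is the tensor product of \<open>b\<close> and the polar form of \<open>\<phi>\<close>; the formula below is its value
  at the sum of the tensors \<open>e\<^sub>i \<otimes> block n v i\<close>.
\<close>

definition tensor_form :: "'a::field mat \<Rightarrow> 'a qform \<Rightarrow> 'a qform" where
  "tensor_form B \<phi> =
     (let m = dim_row B; n = qdim \<phi> in
      QForm (m * n)
        (\<lambda>v. (\<Sum>i<m. B $$ (i, i) * qval \<phi> (block n v i)) +
             (\<Sum>i<m. \<Sum>j<i. B $$ (i, j) * polar \<phi> (block n v i) (block n v j))))"

fun bil_pfister_form :: "'a::field list \<Rightarrow> 'a mat" where
  "bil_pfister_form [] = 1\<^sub>m 1"
| "bil_pfister_form (\<beta> # \<beta>s) =
     bil_tensor (mat_diag 2 (\<lambda>i. if i = 0 then 1 else \<beta>)) (bil_pfister_form \<beta>s)"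

text \<open>As usual, being a Pfister form is understood up to isometry.\<close>

definition bil_pfister :: "nat \<Rightarrow> 'a::field mat \<Rightarrow> bool" where
  "bil_pfister m B \<longleftrightarrow>
     (\<exists>\<beta>s. length \<beta>s = m \<and> 0 \<notin> set \<beta>s \<and> bil_isometric B (bil_pfister_form \<beta>s))"

abbreviation pfister1 :: "'a::field \<Rightarrow> 'a qform" where
  "pfister1 \<alpha> \<equiv> binary_form 1 \<alpha>"

definition quad_pfister :: "nat \<Rightarrow> 'a::field qform \<Rightarrow> bool" where
  "quad_pfister n \<phi> \<longleftrightarrow>
     (\<exists>\<beta>s \<alpha>. length \<beta>s + 1 = n \<and> 0 \<notin> set \<beta>s \<and>
        isometric \<phi> (tensor_form (bil_pfister_form \<beta>s) (pfister1 \<alpha>)))"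

definition Iq :: "nat \<Rightarrow> 'a::field qform set monoid" where
  "Iq n = Iq1\<lparr>carrier :=
     generate Iq1 {witt_class (scale_form c \<phi>) | c \<phi>. c \<noteq> 0 \<and> quad_pfister n \<phi>}\<rparr>"


section \<open>Linkage and tightness\<close>

definition left_linked :: "nat \<Rightarrow> 'a::field qform set \<Rightarrow> bool" where
  "left_linked n S \<longleftrightarrow>
     (\<forall>\<phi>\<in>S. quad_pfister n \<phi>) \<and>
     (\<exists>B. bil_pfister (n - 1) B \<and> (\<forall>\<phi>\<in>S. \<exists>\<alpha>. isometric \<phi> (tensor_form B (pfister1 \<alpha>))))"

definition generated_group :: "nat \<Rightarrow> 'a::field qform set \<Rightarrow> 'a qform set set" where
  "generated_group n S = generate (Iq n) (witt_class ` S)"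

definition strongly_tight :: "nat \<Rightarrow> 'a::field qform set \<Rightarrow> bool" where
  "strongly_tight n S \<longleftrightarrow>
     (\<forall>\<phi>\<in>S. quad_pfister n \<phi>) \<and>
     generated_group n S \<subseteq> {witt_class \<phi> | \<phi>. quad_pfister n \<phi>}"

end

(*
  In characteristic 2, [1,a] + [1,b] is isometric to [1,a+b] + H for a hyperbolic plane H, by a
  change of variables that survives tensoring with a nondegenerate symmetric bilinear form b.  Hence
  a |-> class of b (x) <<a]] is a homomorphism from the additive group of F to I_q^1 F, and the
  group generated by forms b (x) <<a_i]] is the image of the additive group generated by the a_i,
  whose elements are the subset sums because F has characteristic 2.
*)

theory Submission
  imports Defs "Jordan_Normal_Form.Determinant"
begin

no_notation fps_nth (infixl \<open>$\<close> 75)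

section \<open>Linear maps and isometries\<close>

text \<open>The change of variables comes from an isotropic vector: in [1, a] \<bottom> [1, b] the
  two basis vectors of value 1 have a sum of value 1 + 1 = 0. Pairing with this sum is the
  coordinate w + y, one of the two coordinates of the hyperbolic plane that splits off. After
  tensoring, the vectors (x, 0, x, 0) form a totally isotropic subspace for the same reason.

  Before subgroups can be generated, I_q^1 must be known to be a group. Inverses come from
  characteristic 2: -\<phi> = \<phi>, so \<phi> \<bottom> \<phi> should be hyperbolic. Since the
  polar form does not determine \<phi> when 2 = 0, the proof writes \<phi>(v) = L(v, v) with a
  nonsymmetric bilinear L.

  The tensor product is handled through b(x, x) + b(x, y) + \<alpha> b(y, y), with a vector of F^m
  \<otimes> F^2 split into a pair (x, y). Only values of b occur in it, so the b of the linkage can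
  be replaced by an isometric explicit tensor product of diagonal forms, whose symmetry and
  invertibility follow by recursion. As I_q^n is a subgroup of I_q^1, the generated group can be
  computed in I_q^1.\<close>

definition linear_vec :: "nat \<Rightarrow> nat \<Rightarrow> ('a::field vec \<Rightarrow> 'a vec) \<Rightarrow> bool" where
  "linear_vec n m f \<longleftrightarrow>
     (\<forall>v\<in>carrier_vec n. f v \<in> carrier_vec m) \<and>
     (\<forall>v\<in>carrier_vec n. \<forall>w\<in>carrier_vec n. f (v + w) = f v + f w) \<and>
     (\<forall>c. \<forall>v\<in>carrier_vec n. f (c \<cdot>\<^sub>v v) = c \<cdot>\<^sub>v f v)"

lemma linear_vecI:
  assumes "\<And>v. v \<in> carrier_vec n \<Longrightarrow> f v \<in> carrier_vec m"
    and "\<And>v w. v \<in> carrier_vec n \<Longrightarrow> w \<in> carrier_vec n \<Longrightarrow> f (v + w) = f v + f w"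
    and "\<And>c v. v \<in> carrier_vec n \<Longrightarrow> f (c \<cdot>\<^sub>v v) = c \<cdot>\<^sub>v f v"
  shows "linear_vec n m f"
  using assms unfolding linear_vec_def by blast

lemma linear_vecD:
  assumes "linear_vec n m f"
  shows "v \<in> carrier_vec n \<Longrightarrow> f v \<in> carrier_vec m"
    and "v \<in> carrier_vec n \<Longrightarrow> w \<in> carrier_vec n \<Longrightarrow> f (v + w) = f v + f w"
    and "v \<in> carrier_vec n \<Longrightarrow> f (c \<cdot>\<^sub>v v) = c \<cdot>\<^sub>v f v"
  using assms unfolding linear_vec_def by blast+

lemma linear_vec_zero:
  assumes "linear_vec n m f"
  shows "f (0\<^sub>v n) = 0\<^sub>v m"
proof -
  have "(0\<^sub>v n :: 'a vec) = 0 \<cdot>\<^sub>v 0\<^sub>v n" by auto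
  then have "f (0\<^sub>v n) = 0 \<cdot>\<^sub>v f (0\<^sub>v n)"
    using linear_vecD(3)[OF assms, of "0\<^sub>v n" 0] by simp
  also have "\<dots> = 0\<^sub>v m"
    using linear_vecD(1)[OF assms zero_carrier_vec] by auto
  finally show ?thesis .
qed

text \<open>With e_i \<otimes> e_k at index 2i + k, a vector of F^m \<otimes> F^2 is a pair of
  vectors of F^m, read at the even and at the odd positions. An orthogonal sum of m binary forms has
  the same layout.\<close>

definition even_part :: "nat \<Rightarrow> 'a vec \<Rightarrow> 'a vec" where
  "even_part m v = vec m (\<lambda>i. v $ (2 * i))"

definition odd_part :: "nat \<Rightarrow> 'a vec \<Rightarrow> 'a vec" where
  "odd_part m v = vec m (\<lambda>i. v $ (2 * i + 1))"

definition interleave :: "nat \<Rightarrow> 'a vec \<Rightarrow> 'a vec \<Rightarrow> 'a vec" where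
  "interleave m x y = vec (2 * m) (\<lambda>i. if even i then x $ (i div 2) else y $ (i div 2))"

lemma parts_carrier [simp]:
  "even_part m v \<in> carrier_vec m" "odd_part m v \<in> carrier_vec m"
  "interleave m x y \<in> carrier_vec (2 * m)"
  by (auto simp: even_part_def odd_part_def interleave_def)

lemma parts_interleave [simp]:
  assumes "x \<in> carrier_vec m" "y \<in> carrier_vec m"
  shows "even_part m (interleave m x y) = x" "odd_part m (interleave m x y) = y"
  using assms by (auto simp: even_part_def odd_part_def interleave_def intro!: eq_vecI)

lemma interleave_parts [simp]:
  assumes "v \<in> carrier_vec (2 * m)"
  shows "interleave m (even_part m v) (odd_part m v) = v"
  using assms
  by (auto simp: even_part_def odd_part_def interleave_def intro!: eq_vecI elim!: oddE)

lemma interleave_eq_0D: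
  assumes "interleave m x y = 0\<^sub>v (2 * m)" "x \<in> carrier_vec m" "y \<in> carrier_vec m"
  shows "x = 0\<^sub>v m" "y = 0\<^sub>v m"
proof -
  have "even_part m (0\<^sub>v (2 * m)) = (0\<^sub>v m :: 'a vec)" "odd_part m (0\<^sub>v (2 * m)) = (0\<^sub>v m :: 'a vec)"
    by (auto simp: even_part_def odd_part_def)
  then show "x = 0\<^sub>v m" "y = 0\<^sub>v m"
    using parts_interleave[OF assms(2,3)] assms(1) by auto
qed

lemma parts_eq_0D:
  assumes "even_part m v = 0\<^sub>v m" "odd_part m v = 0\<^sub>v m" "v \<in> carrier_vec (2 * m)"
  shows "v = 0\<^sub>v (2 * m)"
proof -
  have "v = interleave m (0\<^sub>v m) (0\<^sub>v m)"
    using interleave_parts[OF assms(3)] assms(1,2) by simp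
  also have "\<dots> = 0\<^sub>v (2 * m)"
    by (auto simp: interleave_def)
  finally show ?thesis .
qed

lemma zero_append_zero: "0\<^sub>v n @\<^sub>v 0\<^sub>v m = 0\<^sub>v (n + m)"
  by auto

lemma append_eq_0D:
  assumes "x @\<^sub>v y = 0\<^sub>v (n + m)" "x \<in> carrier_vec n" "y \<in> carrier_vec m"
  shows "x = 0\<^sub>v n" "y = 0\<^sub>v m"
  using assms append_vec_eq[OF assms(2), of "0\<^sub>v n" y "0\<^sub>v m"] by (simp_all flip: zero_append_zero)

lemma first_last_eq_0D:
  assumes "vec_first v n = 0\<^sub>v n" "vec_last v m = 0\<^sub>v m" "v \<in> carrier_vec (n + m)"
  shows "v = 0\<^sub>v (n + m)"
  using vec_first_last_append[OF assms(3)] assms(1,2) by (simp add: zero_append_zero)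

lemma vec_first_append [simp]: "x \<in> carrier_vec n \<Longrightarrow> vec_first (x @\<^sub>v y) n = x"
  by (auto simp: vec_first_def intro!: eq_vecI)

lemma vec_last_append [simp]: "y \<in> carrier_vec m \<Longrightarrow> vec_last (x @\<^sub>v y) m = y"
  by (auto simp: vec_last_def intro!: eq_vecI)

lemma vec_first_self [simp]: "v \<in> carrier_vec n \<Longrightarrow> vec_first v n = v"
  by (auto simp: vec_first_def intro!: eq_vecI)

section \<open>Closure properties of linear maps\<close>

lemma linear_vec_id: "linear_vec n n (\<lambda>v. v)"
  by (simp add: linear_vec_def)

lemma linear_vec_compose:
  assumes "linear_vec m k g" "linear_vec n m f"
  shows "linear_vec n k (\<lambda>v. g (f v))"
  using assms by (auto simp: linear_vec_def)

lemma linear_vec_append: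
  assumes "linear_vec n a f" "linear_vec n b g"
  shows "linear_vec n (a + b) (\<lambda>v. f v @\<^sub>v g v)"
  by (intro linear_vecI)
    (auto simp: linear_vecD[OF assms(1)] linear_vecD[OF assms(2)] carrier_vecD[OF linear_vecD(1)[OF assms(1)]]
      carrier_vecD[OF linear_vecD(1)[OF assms(2)]] intro!: eq_vecI)

lemma linear_vec_add:
  assumes "linear_vec n m f" "linear_vec n m g"
  shows "linear_vec n m (\<lambda>v. f v + g v)"
proof (rule linear_vecI)
  note fg = linear_vecD[OF assms(1)] linear_vecD[OF assms(2)]
  fix v w :: "'a vec" and c assume v: "v \<in> carrier_vec n"
  show "f v + g v \<in> carrier_vec m" using fg v by auto
  show "f (c \<cdot>\<^sub>v v) + g (c \<cdot>\<^sub>v v) = c \<cdot>\<^sub>v (f v + g v)"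
    using fg(1,4)[OF v] by (simp add: fg v smult_add_distrib_vec[of _ m])
  assume w: "w \<in> carrier_vec n"
  show "f (v + w) + g (v + w) = f v + g v + (f w + g w)"
    using fg(1,4)[OF v, THEN carrier_vecD] fg(1,4)[OF w, THEN carrier_vecD]
    by (auto simp: fg(2,5) v w intro!: eq_vecI)
qed

lemma linear_vec_smult:
  assumes "linear_vec n m f"
  shows "linear_vec n m (\<lambda>v. c \<cdot>\<^sub>v f v)"
  using assms by (auto simp: linear_vec_def smult_add_distrib_vec[of _ m] smult_smult_assoc mult.commute)

lemma linear_vec_mat:
  assumes "A \<in> carrier_mat k m" "linear_vec n m f"
  shows "linear_vec n k (\<lambda>v. A *\<^sub>v f v)"
  using assms by (auto simp: linear_vec_def mult_add_distrib_mat_vec[of _ k m] mult_mat_vec[of _ k m])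

lemma linear_vec_first: "linear_vec (a + b) a (\<lambda>v. vec_first v a)"
  by (auto simp: linear_vec_def vec_first_def intro!: eq_vecI)

lemma linear_vec_last: "linear_vec (a + b) b (\<lambda>v. vec_last v b)"
  by (auto simp: linear_vec_def vec_last_def intro!: eq_vecI)

lemma linear_vec_even_part: "linear_vec (2 * m) m (even_part m)"
  by (auto simp: linear_vec_def even_part_def intro!: eq_vecI)

lemma linear_vec_odd_part: "linear_vec (2 * m) m (odd_part m)"
  by (auto simp: linear_vec_def odd_part_def intro!: eq_vecI)

lemma linear_vec_interleave:
  assumes "linear_vec n m f" "linear_vec n m g"
  shows "linear_vec n (2 * m) (\<lambda>v. interleave m (f v) (g v))"
proof -
  have "i div 2 < m" if "i < 2 * m" for i :: nat using that by auto
  then show ?thesis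
    by (intro linear_vecI)
     (auto simp: interleave_def linear_vecD[OF assms(1)] linear_vecD[OF assms(2)]
      carrier_vecD[OF linear_vecD(1)[OF assms(1)]] carrier_vecD[OF linear_vecD(1)[OF assms(2)]] intro!: eq_vecI)
qed

section \<open>Matrices of linear maps and their inverses\<close>

lemma truncated_vec_Suc:
  fixes v :: "'a::field vec"
  assumes "k < n"
  shows "vec n (\<lambda>i. if i < Suc k then v $ i else 0) =
    vec n (\<lambda>i. if i < k then v $ i else 0) + v $ k \<cdot>\<^sub>v unit_vec n k"
  using assms by (auto simp: unit_vec_def less_Suc_eq intro!: eq_vecI)

text \<open>Filling in one coordinate at a time gives an induction inside the fixed dimension
  \<open>n\<close>. The truncated statement, and not only its case \<open>k = n\<close>, is reused
  to expand a quadratic form.\<close>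

lemma linear_functional_truncated:
  fixes g :: "'a::field vec \<Rightarrow> 'a"
  assumes add: "\<And>v w. v \<in> carrier_vec n \<Longrightarrow> w \<in> carrier_vec n \<Longrightarrow> g (v + w) = g v + g w"
    and smult: "\<And>c v. v \<in> carrier_vec n \<Longrightarrow> g (c \<cdot>\<^sub>v v) = c * g v"
    and "k \<le> n"
  shows "g (vec n (\<lambda>i. if i < k then v $ i else 0)) = (\<Sum>j<k. v $ j * g (unit_vec n j))"
  using \<open>k \<le> n\<close>
proof (induction k)
  case 0
  have "vec n (\<lambda>i. 0) = 0 \<cdot>\<^sub>v (0\<^sub>v n :: 'a vec)" by auto
  then show ?case using smult[of "0\<^sub>v n" 0] by simp
next
  case (Suc k)
  then show ?case
    by (subst truncated_vec_Suc) (simp_all add: add smult)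
qed

lemma linear_functional_sum:
  fixes g :: "'a::field vec \<Rightarrow> 'a"
  assumes "\<And>v w. v \<in> carrier_vec n \<Longrightarrow> w \<in> carrier_vec n \<Longrightarrow> g (v + w) = g v + g w"
    and "\<And>c v. v \<in> carrier_vec n \<Longrightarrow> g (c \<cdot>\<^sub>v v) = c * g v"
    and v: "v \<in> carrier_vec n"
  shows "g v = (\<Sum>j<n. v $ j * g (unit_vec n j))"
proof -
  have "vec n (\<lambda>i. if i < n then v $ i else 0) = v" using v by auto
  then show ?thesis using linear_functional_truncated[where g = g and n = n and k = n and v = v] assms(1,2) by simp
qed

lemma linear_vec_matrix:
  fixes f :: "'a::field vec \<Rightarrow> 'a vec"
  assumes f: "linear_vec n m f"
  obtains P where "P \<in> carrier_mat m n" "\<And>v. v \<in> carrier_vec n \<Longrightarrow> P *\<^sub>v v = f v"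
proof
  let ?P = "mat m n (\<lambda>(i, j). f (unit_vec n j) $ i)"
  show "?P \<in> carrier_mat m n" by simp
  fix v :: "'a vec" assume v: "v \<in> carrier_vec n"
  note fv = linear_vecD[OF f]
  have dim: "dim_vec (f w) = m" if "w \<in> carrier_vec n" for w using fv(1)[OF that] by simp
  show "?P *\<^sub>v v = f v"
  proof (rule eq_vecI)
    fix i assume "i < dim_vec (f v)"
    then have i: "i < m" using dim v by simp
    have "f v $ i = (\<Sum>j<n. v $ j * f (unit_vec n j) $ i)"
      by (rule linear_functional_sum) (use i v in \<open>simp_all add: fv dim\<close>)
    then show "(?P *\<^sub>v v) $ i = f v $ i"
      using i v by (simp add: scalar_prod_def mult.commute lessThan_atLeast0)
  qed (use dim v in simp)
qed

text \<open>Over a field a vanishing determinant produces a nonzero kernel vector. Isometries can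
  therefore be built from maps with trivial kernel, without writing down an inverse.\<close>

lemma invertible_matI:
  fixes A :: "'a::field mat"
  assumes A: "A \<in> carrier_mat n n"
    and ker: "\<And>v. v \<in> carrier_vec n \<Longrightarrow> A *\<^sub>v v = 0\<^sub>v n \<Longrightarrow> v = 0\<^sub>v n"
  shows "invertible_mat A"
proof -
  have "det A \<noteq> 0" using det_0_iff_vec_prod_zero_field[OF A] ker by blast
  then have "A \<in> Units (ring_mat TYPE('a) n ())" by (rule det_non_zero_imp_unit[OF A])
  then show ?thesis
    using A unfolding Units_def invertible_mat_def inverts_mat_def by (auto simp: ring_mat_simps)
qed

lemma invertible_mat_inverse:
  fixes A :: "'a::field mat"
  assumes "A \<in> carrier_mat n n" "invertible_mat A"
  obtains C where "C \<in> carrier_mat n n" "A * C = 1\<^sub>m n" "C * A = 1\<^sub>m n"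
proof -
  from assms obtain C where C: "A * C = 1\<^sub>m n" "C * A = 1\<^sub>m (dim_row C)"
    unfolding invertible_mat_def inverts_mat_def by auto
  \<comment> \<open>Invertibility leaves the shape of \<open>C\<close> open; comparing column counts
    in the two identities fixes it.\<close>
  have "dim_col C = n" using arg_cong[OF C(1), of dim_col] by simp
  moreover have "dim_row C = n" using arg_cong[OF C(2), of dim_col] assms(1) by simp
  ultimately show ?thesis using that[of C] C by auto
qed

lemma invertible_mat_kernel:
  fixes A :: "'a::field mat"
  assumes A: "A \<in> carrier_mat n n" "invertible_mat A" and v: "v \<in> carrier_vec n" "A *\<^sub>v v = 0\<^sub>v n"
  shows "v = 0\<^sub>v n"
proof -
  obtain C where C: "C \<in> carrier_mat n n" "C * A = 1\<^sub>m n"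
    using invertible_mat_inverse[OF A] by metis
  have "v = C *\<^sub>v (A *\<^sub>v v)" using C v(1) A(1) by (metis assoc_mult_mat_vec one_mult_mat_vec)
  also have "\<dots> = 0\<^sub>v n" using C v by auto
  finally show ?thesis .
qed

section \<open>Isometries as injective linear maps\<close>

lemma isometricI:
  assumes "qdim \<phi> = n" "qdim \<psi> = n" and f: "linear_vec n n f"
    and inj: "\<And>v. v \<in> carrier_vec n \<Longrightarrow> f v = 0\<^sub>v n \<Longrightarrow> v = 0\<^sub>v n"
    and val: "\<And>v. v \<in> carrier_vec n \<Longrightarrow> qval \<psi> (f v) = qval \<phi> v"
  shows "isometric \<phi> \<psi>"
proof -
  obtain P where P: "P \<in> carrier_mat n n" "\<And>v. v \<in> carrier_vec n \<Longrightarrow> P *\<^sub>v v = f v"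
    using linear_vec_matrix[OF f] by metis
  have "invertible_mat P" by (rule invertible_matI[OF P(1)]) (use P(2) inj in auto)
  then show ?thesis unfolding isometric_def using assms(1,2) P val by auto
qed

lemma isometricE:
  assumes "isometric \<phi> \<psi>" "qdim \<phi> = n"
  obtains f where "qdim \<psi> = n" "linear_vec n n f"
    "\<And>v. v \<in> carrier_vec n \<Longrightarrow> f v = 0\<^sub>v n \<Longrightarrow> v = 0\<^sub>v n"
    "\<And>v. v \<in> carrier_vec n \<Longrightarrow> qval \<psi> (f v) = qval \<phi> v"
proof -
  from assms obtain P where P: "qdim \<psi> = n" "P \<in> carrier_mat n n" "invertible_mat P"
    "\<And>v. v \<in> carrier_vec n \<Longrightarrow> qval \<psi> (P *\<^sub>v v) = qval \<phi> v"
    unfolding isometric_def by auto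
  show ?thesis
    by (rule that[of "\<lambda>v. P *\<^sub>v v"])
      (use P invertible_mat_kernel[OF P(2,3)] linear_vec_mat[OF P(2) linear_vec_id] in auto)
qed

lemma isometric_eqI:
  assumes "qdim \<phi> = qdim \<psi>" "\<And>v. v \<in> carrier_vec (qdim \<phi>) \<Longrightarrow> qval \<psi> v = qval \<phi> v"
  shows "isometric \<phi> \<psi>"
  by (rule isometricI[of _ "qdim \<phi>" _ "\<lambda>v. v"]) (use assms linear_vec_id in auto)

lemma isometric_refl [simp]: "isometric \<phi> \<phi>"
  by (rule isometric_eqI) auto

lemma isometric_sym:
  assumes "isometric \<phi> \<psi>"
  shows "isometric \<psi> \<phi>"
proof -
  let ?n = "qdim \<phi>"
  from assms obtain P where P: "qdim \<psi> = ?n" "P \<in> carrier_mat ?n ?n" "invertible_mat P"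
    "\<And>v. v \<in> carrier_vec ?n \<Longrightarrow> qval \<psi> (P *\<^sub>v v) = qval \<phi> v"
    unfolding isometric_def by auto
  obtain C where C: "C \<in> carrier_mat ?n ?n" "P * C = 1\<^sub>m ?n" "C * P = 1\<^sub>m ?n"
    using invertible_mat_inverse[OF P(2,3)] by metis
  have PC: "P *\<^sub>v (C *\<^sub>v v) = v" if "v \<in> carrier_vec ?n" for v
    using assoc_mult_mat_vec[OF P(2) C(1) that] C(2) that by simp
  have "v = 0\<^sub>v ?n" if "v \<in> carrier_vec ?n" "C *\<^sub>v v = 0\<^sub>v ?n" for v
    using PC[OF that(1)] that P(2) by auto
  moreover have "qval \<phi> (C *\<^sub>v v) = qval \<psi> v" if "v \<in> carrier_vec ?n" for v
    using P(4)[of "C *\<^sub>v v"] PC[OF that] C(1) that by auto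
  ultimately show ?thesis
    by (intro isometricI[of _ ?n _ "\<lambda>v. C *\<^sub>v v"] linear_vec_mat[OF C(1) linear_vec_id])
      (use C P in auto)
qed

lemma isometric_trans [trans]:
  assumes "isometric \<phi> \<psi>" "isometric \<psi> \<chi>"
  shows "isometric \<phi> \<chi>"
proof -
  let ?n = "qdim \<phi>"
  obtain f where f: "qdim \<psi> = ?n" "linear_vec ?n ?n f"
    "\<And>v. v \<in> carrier_vec ?n \<Longrightarrow> f v = 0\<^sub>v ?n \<Longrightarrow> v = 0\<^sub>v ?n"
    "\<And>v. v \<in> carrier_vec ?n \<Longrightarrow> qval \<psi> (f v) = qval \<phi> v"
    using isometricE[OF assms(1) refl] by metis
  obtain g where g: "qdim \<chi> = ?n" "linear_vec ?n ?n g"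
    "\<And>v. v \<in> carrier_vec ?n \<Longrightarrow> g v = 0\<^sub>v ?n \<Longrightarrow> v = 0\<^sub>v ?n"
    "\<And>v. v \<in> carrier_vec ?n \<Longrightarrow> qval \<chi> (g v) = qval \<psi> v"
    using isometricE[OF assms(2) f(1)] by metis
  show ?thesis
  proof (rule isometricI[of _ ?n _ "\<lambda>v. g (f v)"])
    show "linear_vec ?n ?n (\<lambda>v. g (f v))"
      by (rule linear_vec_compose[OF g(2) f(2)])
  qed (use f(1,3,4) g(1,3,4) linear_vecD(1)[OF f(2)] in auto)
qed

section \<open>Orthogonal sums\<close>

lemma qdim_orth_sum [simp]: "qdim (orth_sum \<phi> \<psi>) = qdim \<phi> + qdim \<psi>"
  by (simp add: orth_sum_def)

lemma qval_orth_sum: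
  "qval (orth_sum \<phi> \<psi>) v = qval \<phi> (vec_first v (qdim \<phi>)) + qval \<psi> (vec_last v (qdim \<psi>))"
  by (simp add: orth_sum_def)

lemma orth_sum_cong:
  assumes "isometric \<phi> \<phi>'" "isometric \<psi> \<psi>'"
  shows "isometric (orth_sum \<phi> \<psi>) (orth_sum \<phi>' \<psi>')"
proof -
  let ?n = "qdim \<phi>" and ?m = "qdim \<psi>"
  obtain f where f: "qdim \<phi>' = ?n" "linear_vec ?n ?n f"
    "\<And>v. v \<in> carrier_vec ?n \<Longrightarrow> f v = 0\<^sub>v ?n \<Longrightarrow> v = 0\<^sub>v ?n"
    "\<And>v. v \<in> carrier_vec ?n \<Longrightarrow> qval \<phi>' (f v) = qval \<phi> v"
    using isometricE[OF assms(1) refl] by metis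
  obtain g where g: "qdim \<psi>' = ?m" "linear_vec ?m ?m g"
    "\<And>v. v \<in> carrier_vec ?m \<Longrightarrow> g v = 0\<^sub>v ?m \<Longrightarrow> v = 0\<^sub>v ?m"
    "\<And>v. v \<in> carrier_vec ?m \<Longrightarrow> qval \<psi>' (g v) = qval \<psi> v"
    using isometricE[OF assms(2) refl] by metis
  note fg = linear_vecD(1)[OF f(2)] linear_vecD(1)[OF g(2)]
  show ?thesis
  proof (rule isometricI[of _ "?n + ?m" _ "\<lambda>v. f (vec_first v ?n) @\<^sub>v g (vec_last v ?m)"])
    show "linear_vec (?n + ?m) (?n + ?m) (\<lambda>v. f (vec_first v ?n) @\<^sub>v g (vec_last v ?m))"
      by (intro linear_vec_append linear_vec_compose[OF f(2)] linear_vec_compose[OF g(2)] linear_vec_first linear_vec_last)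
  next
    fix v :: "'a vec" assume v: "v \<in> carrier_vec (?n + ?m)"
      "f (vec_first v ?n) @\<^sub>v g (vec_last v ?m) = 0\<^sub>v (?n + ?m)"
    then show "v = 0\<^sub>v (?n + ?m)"
      using append_eq_0D[OF v(2) fg] f(3)[of "vec_first v ?n"] g(3)[of "vec_last v ?m"]
      by (intro first_last_eq_0D) simp_all
  qed (use f(1,4) g(1,4) fg in \<open>auto simp: qval_orth_sum\<close>)
qed

lemma orth_sum_comm: "isometric (orth_sum \<phi> \<psi>) (orth_sum \<psi> \<phi>)"
proof -
  let ?n = "qdim \<phi>" and ?m = "qdim \<psi>"
  show ?thesis
  proof (rule isometricI[of _ "?n + ?m" _ "\<lambda>v. vec_last v ?m @\<^sub>v vec_first v ?n"])
    have "linear_vec (?n + ?m) (?m + ?n) (\<lambda>v. vec_last v ?m @\<^sub>v vec_first v ?n)"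
      by (intro linear_vec_append linear_vec_first linear_vec_last)
    then show "linear_vec (?n + ?m) (?n + ?m) (\<lambda>v. vec_last v ?m @\<^sub>v vec_first v ?n)"
      by (simp add: add.commute)
  next
    fix v :: "'a vec" assume v: "v \<in> carrier_vec (?n + ?m)"
      "vec_last v ?m @\<^sub>v vec_first v ?n = 0\<^sub>v (?n + ?m)"
    then show "v = 0\<^sub>v (?n + ?m)"
      using append_eq_0D[of "vec_last v ?m" "vec_first v ?n" ?m ?n]
      by (intro first_last_eq_0D) (simp_all add: add.commute)
  qed (auto simp: qval_orth_sum)
qed

text \<open>Both bracketings cut a coordinate vector at the same two places, so the identity map is
  the isometry.\<close>

lemma orth_sum_assoc: "isometric (orth_sum (orth_sum \<phi> \<psi>) \<chi>) (orth_sum \<phi> (orth_sum \<psi> \<chi>))"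
proof (rule isometric_eqI)
  fix v :: "'a vec"
  let ?n = "qdim \<phi>" and ?m = "qdim \<psi>" and ?k = "qdim \<chi>"
  assume "v \<in> carrier_vec (qdim (orth_sum (orth_sum \<phi> \<psi>) \<chi>))"
  then have v: "dim_vec v = ?n + ?m + ?k" by simp
  have "vec_first (vec_first v (?n + ?m)) ?n = vec_first v ?n"
    "vec_last (vec_first v (?n + ?m)) ?m = vec_first (vec_last v (?m + ?k)) ?m"
    "vec_last (vec_last v (?m + ?k)) ?k = vec_last v ?k"
    using v by (auto simp: vec_first_def vec_last_def ac_simps intro!: eq_vecI)
  then show "qval (orth_sum \<phi> (orth_sum \<psi> \<chi>)) v = qval (orth_sum (orth_sum \<phi> \<psi>) \<chi>) v"
    by (simp add: qval_orth_sum)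
qed simp

section \<open>The zero form and hyperbolic forms\<close>

lemma qdim_zero_form [simp]: "qdim zero_form = 0"
  and qval_zero_form [simp]: "qval zero_form v = 0"
  by (simp_all add: zero_form_def)

lemma orth_sum_zero_right: "isometric (orth_sum \<phi> zero_form) \<phi>"
  by (rule isometric_eqI) (auto simp: qval_orth_sum)

lemma qdim_binary_form [simp]: "qdim (binary_form a b) = 2"
  by (simp add: binary_form_def)

lemma qdim_hyperbolic [simp]: "qdim (hyperbolic k) = 2 * k"
  by (induction k) auto

text \<open>Each plane contributes the product of two neighbouring coordinates. Read as a dot
  product, the form is the pairing of F^k with its dual, which is how later isometries reach
  it.\<close>

lemma qval_hyperbolic:
  assumes "v \<in> carrier_vec (2 * k)"
  shows "qval (hyperbolic k) v = even_part k v \<bullet> odd_part k v"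
proof -
  have "qval (hyperbolic k) v = (\<Sum>i<k. v $ (2 * i) * v $ (2 * i + 1))"
    using assms
  proof (induction k arbitrary: v)
    case (Suc k)
    have "vec_first v 2 $ 0 * vec_first v 2 $ 1 = v $ 0 * v $ 1"
      by (simp add: vec_first_def)
    moreover have "vec_last v (2 * k) $ i = v $ (2 + i)" if "i < 2 * k" for i
      using that Suc.prems by (auto simp: vec_last_def)
    ultimately show ?case
      using Suc by (simp add: qval_orth_sum binary_form_def sum.lessThan_Suc_shift del: sum.lessThan_Suc)
  qed simp
  also have "\<dots> = even_part k v \<bullet> odd_part k v"
    by (simp add: scalar_prod_def even_part_def odd_part_def lessThan_atLeast0)
  finally show ?thesis .
qed

lemma hyperbolic_add: "isometric (orth_sum (hyperbolic i) (hyperbolic j)) (hyperbolic (i + j))"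
proof (induction i)
  case 0
  have "isometric (orth_sum zero_form (hyperbolic j)) (hyperbolic j)"
    by (rule isometric_trans[OF orth_sum_comm orth_sum_zero_right])
  then show ?case by simp
next
  case (Suc i)
  show ?case
    unfolding add_Suc hyperbolic.simps
    by (rule isometric_trans[OF orth_sum_assoc orth_sum_cong[OF isometric_refl Suc]])
qed

lemma orth_sum_hyperbolic_add:
  "isometric (orth_sum (orth_sum \<phi> (hyperbolic i)) (hyperbolic j)) (orth_sum \<phi> (hyperbolic (i + j)))"
  by (rule isometric_trans[OF orth_sum_assoc orth_sum_cong[OF isometric_refl hyperbolic_add]])

lemma orth_sum_right_comm:
  "isometric (orth_sum (orth_sum \<phi> \<psi>) \<chi>) (orth_sum (orth_sum \<phi> \<chi>) \<psi>)"
  by (meson isometric_refl isometric_sym isometric_trans orth_sum_assoc orth_sum_comm orth_sum_cong)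

section \<open>The Witt group\<close>

lemma witt_equivI: "isometric \<phi> \<psi> \<Longrightarrow> witt_equiv \<phi> \<psi>"
  unfolding witt_equiv_def by (meson isometric_refl orth_sum_cong)

lemma witt_equiv_sym: "witt_equiv \<phi> \<psi> \<Longrightarrow> witt_equiv \<psi> \<phi>"
  unfolding witt_equiv_def by (meson isometric_sym)

text \<open>Stabilising the first isometry by \<open>k\<close> planes and the second by
  \<open>j\<close> makes both pass through \<open>\<psi>\<close> with \<open>j + k\<close>
  planes.\<close>

lemma witt_equiv_trans [trans]:
  assumes "witt_equiv \<phi> \<psi>" "witt_equiv \<psi> \<chi>"
  shows "witt_equiv \<phi> \<chi>"
proof -
  obtain i j k l where ij: "isometric (orth_sum \<phi> (hyperbolic i)) (orth_sum \<psi> (hyperbolic j))"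
    and kl: "isometric (orth_sum \<psi> (hyperbolic k)) (orth_sum \<chi> (hyperbolic l))"
    using assms unfolding witt_equiv_def by blast
  have "isometric (orth_sum \<phi> (hyperbolic (i + k))) (orth_sum (orth_sum \<psi> (hyperbolic j)) (hyperbolic k))"
    by (meson ij isometric_refl isometric_sym isometric_trans orth_sum_cong orth_sum_hyperbolic_add)
  also have "isometric \<dots> (orth_sum (orth_sum \<psi> (hyperbolic k)) (hyperbolic j))"
    by (rule orth_sum_right_comm)
  also have "isometric \<dots> (orth_sum \<chi> (hyperbolic (l + j)))"
    by (meson kl isometric_refl isometric_trans orth_sum_cong orth_sum_hyperbolic_add)
  finally show ?thesis unfolding witt_equiv_def by blast
qed

lemma witt_equiv_orth_sum_left:
  assumes "witt_equiv \<phi> \<phi>'"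
  shows "witt_equiv (orth_sum \<phi> \<psi>) (orth_sum \<phi>' \<psi>)"
proof -
  obtain i j where "isometric (orth_sum \<phi> (hyperbolic i)) (orth_sum \<phi>' (hyperbolic j))"
    using assms unfolding witt_equiv_def by blast
  then have "isometric (orth_sum (orth_sum \<phi> \<psi>) (hyperbolic i)) (orth_sum (orth_sum \<phi>' \<psi>) (hyperbolic j))"
    by (meson isometric_refl isometric_trans orth_sum_cong orth_sum_right_comm)
  then show ?thesis unfolding witt_equiv_def by blast
qed

lemma witt_equiv_orth_sum:
  assumes "witt_equiv \<phi> \<phi>'" "witt_equiv \<psi> \<psi>'"
  shows "witt_equiv (orth_sum \<phi> \<psi>) (orth_sum \<phi>' \<psi>')"
  by (meson assms orth_sum_comm witt_equivI witt_equiv_orth_sum_left witt_equiv_trans)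

lemma witt_equiv_hyperbolic: "witt_equiv (orth_sum \<phi> (hyperbolic k)) \<phi>"
  unfolding witt_equiv_def
  by (metis hyperbolic.simps(1) orth_sum_zero_right)

lemma witt_class_eq: "witt_equiv \<phi> \<psi> \<Longrightarrow> witt_class \<phi> = witt_class \<psi>"
  unfolding witt_class_def by (auto intro: witt_equiv_trans witt_equiv_sym)

lemma witt_class_self: "\<phi> \<in> even_nonsingular \<Longrightarrow> \<phi> \<in> witt_class \<phi>"
  by (simp add: witt_class_def witt_equivI)

section \<open>Even-dimensional nonsingular forms and their classes\<close>

lemma quadratic_formD:
  assumes "quadratic_form \<phi>"
  shows "v \<in> carrier_vec (qdim \<phi>) \<Longrightarrow> qval \<phi> (c \<cdot>\<^sub>v v) = c\<^sup>2 * qval \<phi> v"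
    and "u \<in> carrier_vec (qdim \<phi>) \<Longrightarrow> v \<in> carrier_vec (qdim \<phi>) \<Longrightarrow> w \<in> carrier_vec (qdim \<phi>) \<Longrightarrow>
      polar \<phi> (u + v) w = polar \<phi> u w + polar \<phi> v w"
    and "v \<in> carrier_vec (qdim \<phi>) \<Longrightarrow> w \<in> carrier_vec (qdim \<phi>) \<Longrightarrow>
      polar \<phi> (c \<cdot>\<^sub>v v) w = c * polar \<phi> v w"
  using assms unfolding quadratic_form_def by blast+

lemma polar_orth_sum:
  assumes "v \<in> carrier_vec (qdim \<phi> + qdim \<psi>)" "w \<in> carrier_vec (qdim \<phi> + qdim \<psi>)"
  shows "polar (orth_sum \<phi> \<psi>) v w =
    polar \<phi> (vec_first v (qdim \<phi>)) (vec_first w (qdim \<phi>)) +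
    polar \<psi> (vec_last v (qdim \<psi>)) (vec_last w (qdim \<psi>))"
  using linear_vecD(2)[OF linear_vec_first assms] linear_vecD(2)[OF linear_vec_last assms]
  by (simp add: polar_def qval_orth_sum)

lemma qval_zero:
  fixes \<phi> :: "'a::field qform"
  assumes "quadratic_form \<phi>"
  shows "qval \<phi> (0\<^sub>v (qdim \<phi>)) = 0"
proof -
  have "0 \<cdot>\<^sub>v 0\<^sub>v (qdim \<phi>) = (0\<^sub>v (qdim \<phi>) :: 'a vec)" by auto
  then show ?thesis using quadratic_formD(1)[OF assms, of "0\<^sub>v (qdim \<phi>)" 0] by simp
qed

lemma polar_zero_right:
  assumes "quadratic_form \<phi>" "v \<in> carrier_vec (qdim \<phi>)"
  shows "polar \<phi> v (0\<^sub>v (qdim \<phi>)) = 0"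
  using assms by (simp add: polar_def qval_zero)

lemma quadratic_form_orth_sum:
  assumes "quadratic_form \<phi>" "quadratic_form \<psi>"
  shows "quadratic_form (orth_sum \<phi> \<psi>)"
  unfolding quadratic_form_def qdim_orth_sum
proof (intro conjI ballI allI)
  note first = linear_vecD[OF linear_vec_first[of "qdim \<phi>" "qdim \<psi>"]]
  note last = linear_vecD[OF linear_vec_last[of "qdim \<phi>" "qdim \<psi>"]]
  note qf = quadratic_formD[OF assms(1)] quadratic_formD[OF assms(2)]
  fix u v w :: "'a vec" and c :: 'a
  assume v: "v \<in> carrier_vec (qdim \<phi> + qdim \<psi>)"
  show "qval (orth_sum \<phi> \<psi>) (c \<cdot>\<^sub>v v) = c\<^sup>2 * qval (orth_sum \<phi> \<psi>) v"
    using v by (simp add: qval_orth_sum first last qf algebra_simps)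
  assume w: "w \<in> carrier_vec (qdim \<phi> + qdim \<psi>)"
  show "polar (orth_sum \<phi> \<psi>) (c \<cdot>\<^sub>v v) w = c * polar (orth_sum \<phi> \<psi>) v w"
    using v w by (simp add: polar_orth_sum first last qf algebra_simps)
  assume u: "u \<in> carrier_vec (qdim \<phi> + qdim \<psi>)"
  show "polar (orth_sum \<phi> \<psi>) (u + v) w = polar (orth_sum \<phi> \<psi>) u w + polar (orth_sum \<phi> \<psi>) v w"
    using u v w by (simp add: polar_orth_sum first last qf algebra_simps)
qed

lemma nonsingular_orth_sum:
  assumes qf: "quadratic_form \<phi>" "quadratic_form \<psi>" and ns: "nonsingular \<phi>" "nonsingular \<psi>"
  shows "nonsingular (orth_sum \<phi> \<psi>)"
  unfolding nonsingular_def qdim_orth_sum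
proof (intro ballI impI)
  fix v :: "'a vec"
  assume v: "v \<in> carrier_vec (qdim \<phi> + qdim \<psi>)"
    and orth: "\<forall>w\<in>carrier_vec (qdim \<phi> + qdim \<psi>). polar (orth_sum \<phi> \<psi>) v w = 0"
  \<comment> \<open>Test vectors supported on one summand isolate the corresponding component of
    \<open>v\<close>.\<close>
  have "polar \<phi> (vec_first v (qdim \<phi>)) w = 0" if "w \<in> carrier_vec (qdim \<phi>)" for w
    using orth[rule_format, of "w @\<^sub>v 0\<^sub>v (qdim \<psi>)"] v that
    by (simp add: polar_orth_sum polar_zero_right qf)
  then have 1: "vec_first v (qdim \<phi>) = 0\<^sub>v (qdim \<phi>)"
    using ns(1) unfolding nonsingular_def by simp
  have "polar \<psi> (vec_last v (qdim \<psi>)) w = 0" if "w \<in> carrier_vec (qdim \<psi>)" for w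
    using orth[rule_format, of "0\<^sub>v (qdim \<phi>) @\<^sub>v w"] v that
    by (simp add: polar_orth_sum polar_zero_right qf)
  then have "vec_last v (qdim \<psi>) = 0\<^sub>v (qdim \<psi>)"
    using ns(2) unfolding nonsingular_def by simp
  with 1 v show "v = 0\<^sub>v (qdim \<phi> + qdim \<psi>)" by (intro first_last_eq_0D)
qed

lemma even_nonsingular_orth_sum:
  "\<phi> \<in> even_nonsingular \<Longrightarrow> \<psi> \<in> even_nonsingular \<Longrightarrow> orth_sum \<phi> \<psi> \<in> even_nonsingular"
  by (simp add: even_nonsingular_def quadratic_form_orth_sum nonsingular_orth_sum)

lemma even_nonsingular_zero_form: "zero_form \<in> even_nonsingular"
  by (auto simp: even_nonsingular_def quadratic_form_def nonsingular_def polar_def)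

text \<open>The product is a union over all representatives. It collapses to one class because the
  summands all agree and both index sets are nonempty, each form representing its own class.\<close>

lemma witt_class_mult:
  assumes "\<phi> \<in> even_nonsingular" "\<psi> \<in> even_nonsingular"
  shows "witt_class \<phi> \<otimes>\<^bsub>Iq1\<^esub> witt_class \<psi> = witt_class (orth_sum \<phi> \<psi>)"
proof -
  have "witt_class (orth_sum \<phi>' \<psi>') = witt_class (orth_sum \<phi> \<psi>)"
    if "\<phi>' \<in> witt_class \<phi>" "\<psi>' \<in> witt_class \<psi>" for \<phi>' \<psi>'
    using that by (intro witt_class_eq witt_equiv_orth_sum) (auto simp: witt_class_def witt_equiv_sym)
  then have "witt_class \<phi> \<otimes>\<^bsub>Iq1\<^esub> witt_class \<psi> =
      (\<Union>\<phi>'\<in>witt_class \<phi>. \<Union>\<psi>'\<in>witt_class \<psi>. witt_class (orth_sum \<phi> \<psi>))"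
    by (simp add: Iq1_def)
  then show ?thesis
    using witt_class_self[OF assms(1)] witt_class_self[OF assms(2)] by auto
qed

lemma carrier_Iq1: "carrier Iq1 = witt_class ` even_nonsingular"
  and one_Iq1: "\<one>\<^bsub>Iq1\<^esub> = witt_class zero_form"
  by (simp_all add: Iq1_def)

section \<open>The Witt group in characteristic 2\<close>

lemma char2_two:
  assumes "CHAR('a::field) = 2"
  shows "(2::'a) = 0"
  using of_nat_CHAR[where 'a = 'a] assms by simp

lemma char2_add_self:
  assumes "CHAR('a::field) = 2"
  shows "x + x = (0::'a)"
  using char2_two[OF assms] by (simp flip: mult_2)

lemma char2_uminus:
  assumes "CHAR('a::field) = 2"
  shows "- x = (x::'a)"
  using char2_add_self[OF assms] by (metis neg_eq_iff_add_eq_0)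

lemma char2_minus:
  assumes "CHAR('a::field) = 2"
  shows "x - y = x + (y::'a)"
  using char2_uminus[OF assms] by (metis diff_conv_add_uminus)

lemma char2_add_self_left:
  assumes "CHAR('a::field) = 2"
  shows "x + (x + y) = (y::'a)"
  using char2_add_self[OF assms] by (metis add.assoc add_0)

lemmas char2_simps = char2_two char2_add_self char2_add_self_left char2_uminus char2_minus

lemma char2_add_self_vec:
  assumes "CHAR('a::field) = 2" "v \<in> carrier_vec n"
  shows "v + v = (0\<^sub>v n :: 'a vec)"
  using assms by (auto simp: char2_add_self intro!: eq_vecI)

section \<open>Linear maps representing a quadratic form and its polar form\<close>

lemma polar_sym:
  assumes "v \<in> carrier_vec (qdim \<phi>)" "w \<in> carrier_vec (qdim \<phi>)"
  shows "polar \<phi> v w = polar \<phi> w v"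
  unfolding polar_def by (subst comm_add_vec[OF assms]) simp

lemma polar_linear_vec:
  assumes qf: "quadratic_form \<phi>" and n: "qdim \<phi> = n"
  obtains N where "linear_vec n n N"
    "\<And>u v. u \<in> carrier_vec n \<Longrightarrow> v \<in> carrier_vec n \<Longrightarrow> polar \<phi> u v = u \<bullet> N v"
proof
  let ?N = "\<lambda>v. vec n (\<lambda>j. polar \<phi> v (unit_vec n j))"
  note q = quadratic_formD[OF qf, unfolded n]
  show "linear_vec n n ?N"
    by (rule linear_vecI) (auto simp: q intro!: eq_vecI)
  fix u v :: "'a vec" assume uv: "u \<in> carrier_vec n" "v \<in> carrier_vec n"
  have "polar \<phi> u v = (\<Sum>j<n. u $ j * polar \<phi> (unit_vec n j) v)"
    by (rule linear_functional_sum[where g = "\<lambda>u. polar \<phi> u v"]) (use uv in \<open>simp_all add: q\<close>)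
  also have "\<dots> = (\<Sum>j<n. u $ j * polar \<phi> v (unit_vec n j))"
    using uv(2) n by (simp add: polar_sym[of v])
  finally show "polar \<phi> u v = u \<bullet> ?N v"
    by (simp add: scalar_prod_def lessThan_atLeast0)
qed

text \<open>A triangular matrix, with the values of \<phi> at the unit vectors on the diagonal and
  polar values on one side of it, represents \<phi> in every characteristic. A symmetric matrix
  would give only diagonal forms in characteristic 2.\<close>

lemma quadratic_form_linear_vec:
  assumes qf: "quadratic_form \<phi>" and n: "qdim \<phi> = n"
  obtains L where "linear_vec n n L" "\<And>v. v \<in> carrier_vec n \<Longrightarrow> qval \<phi> v = v \<bullet> L v"
proof
  define L where "L v = vec n (\<lambda>i. (\<Sum>j<i. v $ j * polar \<phi> (unit_vec n j) (unit_vec n i)) +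
    v $ i * qval \<phi> (unit_vec n i))" for v
  note q = quadratic_formD[OF qf, unfolded n]
  show "linear_vec n n L"
    by (rule linear_vecI)
      (auto simp: L_def algebra_simps sum.distrib sum_distrib_left intro!: eq_vecI)
  fix v :: "'a vec" assume v: "v \<in> carrier_vec n"
  \<comment> \<open>Adding coordinate \<open>k\<close> to the truncated vector contributes its own
    square term and its polar terms with the earlier coordinates, which together are
    \<open>v $ k * L v $ k\<close>.\<close>
  have "qval \<phi> (vec n (\<lambda>i. if i < k then v $ i else 0)) = (\<Sum>i<k. v $ i * L v $ i)"
    if "k \<le> n" for k
    using that
  proof (induction k)
    case 0
    have "vec n (\<lambda>i. 0) = (0\<^sub>v n :: 'a vec)" by auto
    then show ?case using qval_zero[OF qf] n by simp
  next
    case (Suc k)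
    let ?T = "vec n (\<lambda>i. if i < k then v $ i else 0)" and ?e = "unit_vec n k :: 'a vec"
    have "qval \<phi> (?T + v $ k \<cdot>\<^sub>v ?e) = qval \<phi> ?T + qval \<phi> (v $ k \<cdot>\<^sub>v ?e) + polar \<phi> ?T (v $ k \<cdot>\<^sub>v ?e)"
      by (simp add: polar_def)
    also have "polar \<phi> ?T (v $ k \<cdot>\<^sub>v ?e) = v $ k * polar \<phi> ?T ?e"
      using n by (simp add: polar_sym[of ?T] q)
    also have "polar \<phi> ?T ?e = (\<Sum>j<k. v $ j * polar \<phi> (unit_vec n j) ?e)"
      by (rule linear_functional_truncated[where g = "\<lambda>u. polar \<phi> u ?e"]) (use Suc.prems in \<open>simp_all add: q\<close>)
    finally show ?case
      using Suc by (simp add: truncated_vec_Suc q L_def algebra_simps power2_eq_square)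
  qed
  moreover have "vec n (\<lambda>i. if i < n then v $ i else 0) = v" using v by auto
  ultimately have "qval \<phi> v = (\<Sum>i<n. v $ i * L v $ i)" by (metis order.refl)
  then show "qval \<phi> v = v \<bullet> L v"
    by (simp add: scalar_prod_def L_def lessThan_atLeast0)
qed

text \<open>
  With \<open>u = v + w\<close> and a (non-symmetric) bilinear form \<open>L\<close> such that \<open>\<phi>(u) = L(u, u)\<close>, one has
  \<open>\<phi>(v) + \<phi>(w) = L(u, u) + b\<^sub>\<phi>(u, v)\<close>, which is linear in the first copy of \<open>u\<close>.
\<close>

lemma orth_sum_self_hyperbolic:
  fixes \<phi> :: "'a::field qform"
  assumes char2: "CHAR('a) = 2" and qf: "quadratic_form \<phi>" and ns: "nonsingular \<phi>"
  shows "isometric (orth_sum \<phi> \<phi>) (hyperbolic (qdim \<phi>))"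
proof -
  define n where "n = qdim \<phi>"
  obtain L where L: "linear_vec n n L" "\<And>v. v \<in> carrier_vec n \<Longrightarrow> qval \<phi> v = v \<bullet> L v"
    using quadratic_form_linear_vec[OF qf n_def[symmetric]] by metis
  obtain N where N: "linear_vec n n N"
    "\<And>u v. u \<in> carrier_vec n \<Longrightarrow> v \<in> carrier_vec n \<Longrightarrow> polar \<phi> u v = u \<bullet> N v"
    using polar_linear_vec[OF qf n_def[symmetric]] by metis
  note LN = linear_vecD(1)[OF L(1)] linear_vecD(1)[OF N(1)]
  \<comment> \<open>The even part is the sum u of the two components; the odd part is the vector
    whose dot product with u is L(u, u) plus the polar value of u and the first component.\<close>
  let ?f = "\<lambda>v. interleave n (vec_first v n + vec_last v n)
    (L (vec_first v n + vec_last v n) + N (vec_first v n))"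
  have lin: "linear_vec (n + n) (2 * n) ?f"
    by (intro linear_vec_interleave linear_vec_add linear_vec_first linear_vec_last
        linear_vec_compose[OF L(1)] linear_vec_compose[OF N(1)])
  have inj: "v = 0\<^sub>v (n + n)" if v: "v \<in> carrier_vec (n + n)" "?f v = 0\<^sub>v (2 * n)" for v
  proof -
    let ?a = "vec_first v n" and ?b = "vec_last v n"
    have ab: "?a + ?b = 0\<^sub>v n" and LNa: "L (?a + ?b) + N ?a = 0\<^sub>v n"
      using interleave_eq_0D[OF v(2)] LN by auto
    \<comment> \<open>\<open>N ?a\<close> represents pairing with \<open>?a\<close>, so its
      vanishing puts \<open>?a\<close> into the radical of the polar form.\<close>
    then have "N ?a = 0\<^sub>v n"
      using LN(2)[of ?a] linear_vec_zero[OF L(1)] by simp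
    then have "polar \<phi> ?a w = 0" if "w \<in> carrier_vec n" for w
      using N(2)[of w ?a] that by (simp add: polar_sym n_def)
    then have a: "?a = 0\<^sub>v n"
      using ns unfolding nonsingular_def n_def by simp
    moreover from this have "?b = 0\<^sub>v n" using ab by simp
    ultimately show ?thesis using v(1) by (intro first_last_eq_0D)
  qed
  have val: "qval (hyperbolic n) (?f v) = qval (orth_sum \<phi> \<phi>) v" for v
  proof -
    let ?a = "vec_first v n" and ?b = "vec_last v n"
    have "polar \<phi> ?a ?a = 0"
      using char2_add_self_vec[OF char2, of ?a n] qval_zero[OF qf]
      by (simp add: polar_def char2_simps[OF char2] n_def)
    then have "polar \<phi> (?a + ?b) ?a = polar \<phi> ?a ?b"
      using quadratic_formD(2)[OF qf, of ?a ?b ?a] by (simp add: polar_sym n_def)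
    also have "\<dots> = qval \<phi> (?a + ?b) + qval \<phi> ?a + qval \<phi> ?b"
      by (simp add: polar_def char2_minus[OF char2])
    finally have "qval \<phi> (?a + ?b) + polar \<phi> (?a + ?b) ?a = qval \<phi> ?a + qval \<phi> ?b"
      by (simp add: char2_simps[OF char2] add.assoc)
    moreover have "qval (hyperbolic n) (?f v) = qval \<phi> (?a + ?b) + polar \<phi> (?a + ?b) ?a"
      using LN by (simp add: qval_hyperbolic L(2) N(2) scalar_prod_add_distrib[of _ n])
    ultimately show ?thesis by (simp add: qval_orth_sum n_def)
  qed
  show ?thesis
    using isometricI[of "orth_sum \<phi> \<phi>" "n + n" "hyperbolic n" ?f] lin inj val
    by (simp add: n_def mult_2)
qed

lemma witt_class_self_inverse:
  fixes \<phi> :: "'a::field qform"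
  assumes "CHAR('a) = 2" "\<phi> \<in> even_nonsingular"
  shows "witt_class \<phi> \<otimes>\<^bsub>Iq1\<^esub> witt_class \<phi> = \<one>\<^bsub>Iq1\<^esub>"
proof -
  have "isometric (orth_sum \<phi> \<phi>) (hyperbolic (qdim \<phi>))"
    using assms by (intro orth_sum_self_hyperbolic) (auto simp: even_nonsingular_def)
  then have "witt_equiv (orth_sum \<phi> \<phi>) (orth_sum zero_form (hyperbolic (qdim \<phi>)))"
    by (meson isometric_sym isometric_trans orth_sum_comm orth_sum_zero_right witt_equivI)
  then have "witt_class (orth_sum \<phi> \<phi>) = witt_class zero_form"
    by (rule witt_class_eq[OF witt_equiv_trans[OF _ witt_equiv_hyperbolic]])
  then show ?thesis
    using assms(2) by (simp add: witt_class_mult one_Iq1)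
qed

lemma group_Iq1:
  assumes char2: "CHAR('a::field) = 2"
  shows "group (Iq1 :: 'a qform set monoid)"
proof (rule groupI)
  fix X Y Z :: "'a qform set"
  assume "X \<in> carrier Iq1"
  then obtain \<phi> where \<phi>: "X = witt_class \<phi>" "\<phi> \<in> even_nonsingular" by (auto simp: carrier_Iq1)
  have "witt_class (orth_sum zero_form \<phi>) = witt_class \<phi>"
    by (intro witt_class_eq witt_equivI isometric_trans[OF orth_sum_comm orth_sum_zero_right])
  then show "\<one>\<^bsub>Iq1\<^esub> \<otimes>\<^bsub>Iq1\<^esub> X = X"
    using \<phi> by (simp add: one_Iq1 witt_class_mult even_nonsingular_zero_form)
  show "\<exists>Y\<in>carrier Iq1. Y \<otimes>\<^bsub>Iq1\<^esub> X = \<one>\<^bsub>Iq1\<^esub>"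
    using \<phi> witt_class_self_inverse[OF char2] \<open>X \<in> carrier Iq1\<close> by auto
  assume "Y \<in> carrier Iq1"
  then obtain \<psi> where \<psi>: "Y = witt_class \<psi>" "\<psi> \<in> even_nonsingular" by (auto simp: carrier_Iq1)
  show "X \<otimes>\<^bsub>Iq1\<^esub> Y \<in> carrier Iq1"
    using \<phi> \<psi> by (auto simp: carrier_Iq1 witt_class_mult even_nonsingular_orth_sum)
  assume "Z \<in> carrier Iq1"
  then obtain \<chi> where \<chi>: "Z = witt_class \<chi>" "\<chi> \<in> even_nonsingular" by (auto simp: carrier_Iq1)
  show "X \<otimes>\<^bsub>Iq1\<^esub> Y \<otimes>\<^bsub>Iq1\<^esub> Z = X \<otimes>\<^bsub>Iq1\<^esub> (Y \<otimes>\<^bsub>Iq1\<^esub> Z)"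
    using \<phi> \<psi> \<chi> witt_class_eq[OF witt_equivI[OF orth_sum_assoc[of \<phi> \<psi> \<chi>]]]
    by (simp add: witt_class_mult even_nonsingular_orth_sum)
qed (auto simp: carrier_Iq1 one_Iq1 even_nonsingular_zero_form)

section \<open>Tensor products with a symmetric bilinear form\<close>

text \<open>Links the full double sum of a Gram matrix with \<open>tensor_form\<close>, which sums
  over the diagonal and over the pairs \<open>j < i\<close>.\<close>

lemma sum_square_split:
  fixes f :: "nat \<Rightarrow> nat \<Rightarrow> 'a::comm_monoid_add"
  shows "(\<Sum>i<m. \<Sum>j<m. f i j) = (\<Sum>i<m. f i i) + (\<Sum>i<m. \<Sum>j<i. f i j + f j i)"
  by (induction m) (simp_all add: sum.distrib ac_simps)

lemma bilinear_eq_sum: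
  fixes B :: "'a::field mat"
  assumes "B \<in> carrier_mat m m" "x \<in> carrier_vec m" "y \<in> carrier_vec m"
  shows "x \<bullet> (B *\<^sub>v y) = (\<Sum>i<m. \<Sum>j<m. B $$ (i, j) * x $ i * y $ j)"
  using assms by (simp add: scalar_prod_def lessThan_atLeast0 sum_distrib_left ac_simps)

lemma qdim_tensor_form: "qdim (tensor_form B \<phi>) = dim_row B * qdim \<phi>"
  by (simp add: tensor_form_def Let_def)

text \<open>The polar form of [1, \<alpha>] is \<open>x i * y j + x j * y i\<close>, so the mixed
  terms assemble to b(x, y). In b(x, x) and b(y, y) the off-diagonal terms cancel in pairs by
  symmetry, which leaves exactly the diagonal sums of \<open>tensor_form\<close>. The result is free
  of coordinates in b.\<close>

lemma qval_tensor_pfister1: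
  fixes B :: "'a::field mat"
  assumes char2: "CHAR('a) = 2" and B: "B \<in> carrier_mat m m" "transpose_mat B = B"
  shows "qval (tensor_form B (pfister1 \<alpha>)) v =
    even_part m v \<bullet> (B *\<^sub>v even_part m v) + even_part m v \<bullet> (B *\<^sub>v odd_part m v) +
    \<alpha> * (odd_part m v \<bullet> (B *\<^sub>v odd_part m v))"
proof -
  define x where "x i = v $ (2 * i)" for i
  define y where "y i = v $ (2 * i + 1)" for i
  have sym: "B $$ (i, j) = B $$ (j, i)" if "i < m" "j < m" for i j
    using that B(1) arg_cong[OF B(2), of "\<lambda>M. M $$ (i, j)"] by simp
  have block: "block 2 v i $ 0 = x i" "block 2 v i $ 1 = y i" for i
    by (simp_all add: block_def x_def y_def mult.commute)
  have pol: "polar (pfister1 \<alpha>) (block 2 v i) (block 2 v j) = x i * y j + x j * y i" for i j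
    using block block[unfolded One_nat_def]
    by (simp add: polar_def binary_form_def block_def power2_eq_square char2_simps[OF char2] algebra_simps)
  have val: "qval (pfister1 \<alpha>) (block 2 v i) = x i * x i + x i * y i + \<alpha> * (y i * y i)" for i
    using block[of i] by (simp add: binary_form_def power2_eq_square)
  have diag: "(\<Sum>i<m. \<Sum>j<m. B $$ (i, j) * z i * z j) = (\<Sum>i<m. B $$ (i, i) * z i * z i)" for z
  proof -
    have "(\<Sum>j<i. B $$ (i, j) * z i * z j + B $$ (j, i) * z j * z i) = 0" if "i < m" for i
      using that by (intro sum.neutral) (simp add: sym[of _ i] char2_simps[OF char2] ac_simps)
    then show ?thesis by (simp add: sum_square_split)
  qed
  have mixed: "(\<Sum>i<m. \<Sum>j<m. B $$ (i, j) * x i * y j) =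
    (\<Sum>i<m. B $$ (i, i) * x i * y i) + (\<Sum>i<m. \<Sum>j<i. B $$ (i, j) * (x i * y j + x j * y i))"
  proof -
    have "(\<Sum>j<i. B $$ (i, j) * x i * y j + B $$ (j, i) * x j * y i) =
        (\<Sum>j<i. B $$ (i, j) * (x i * y j + x j * y i))" if "i < m" for i
      using that by (intro sum.cong) (simp_all add: sym[of _ i] algebra_simps)
    then show ?thesis by (simp add: sum_square_split)
  qed
  have "qval (tensor_form B (pfister1 \<alpha>)) v =
      (\<Sum>i<m. B $$ (i, i) * x i * x i) + (\<Sum>i<m. B $$ (i, i) * x i * y i) +
      \<alpha> * (\<Sum>i<m. B $$ (i, i) * y i * y i) + (\<Sum>i<m. \<Sum>j<i. B $$ (i, j) * (x i * y j + x j * y i))"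
    using B(1)
    by (simp add: tensor_form_def Let_def val pol sum.distrib sum_distrib_left algebra_simps)
  also have "\<dots> = (\<Sum>i<m. \<Sum>j<m. B $$ (i, j) * x i * x j) + (\<Sum>i<m. \<Sum>j<m. B $$ (i, j) * x i * y j) +
      \<alpha> * (\<Sum>i<m. \<Sum>j<m. B $$ (i, j) * y i * y j)"
    unfolding diag mixed by (simp add: ac_simps)
  finally show ?thesis
    using B(1) by (simp add: bilinear_eq_sum even_part_def odd_part_def x_def y_def)
qed

text \<open>The value formula involves the Gram matrix only through values of b at the even and odd
  parts, so applying \<open>P\<close> to both parts is an isometry. Symmetry of \<open>B\<close> is
  inherited from \<open>C\<close>.\<close>

lemma tensor_form_bil_isometric:
  fixes B C :: "'a::field mat"
  assumes char2: "CHAR('a) = 2" and BC: "bil_isometric B C" and sym: "transpose_mat C = C"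
  shows "isometric (tensor_form B (pfister1 \<alpha>)) (tensor_form C (pfister1 \<alpha>))"
proof -
  obtain m P where m: "B \<in> carrier_mat m m" "C \<in> carrier_mat m m"
    and P: "P \<in> carrier_mat m m" "invertible_mat P" "B = transpose_mat P * C * P"
    using BC unfolding bil_isometric_def by blast
  have "transpose_mat B = B"
    using m P(1) by (simp add: P(3) transpose_mult[of _ m m _ m] sym)
  note val = qval_tensor_pfister1[OF char2 m(1) this] qval_tensor_pfister1[OF char2 m(2) sym]
  have PCP: "x \<bullet> (B *\<^sub>v y) = (P *\<^sub>v x) \<bullet> (C *\<^sub>v (P *\<^sub>v y))"
    if "x \<in> carrier_vec m" "y \<in> carrier_vec m" for x y
  proof -
    have "B *\<^sub>v y = transpose_mat P *\<^sub>v (C *\<^sub>v (P *\<^sub>v y))"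
      using m P(1) that by (simp add: P(3) assoc_mult_mat_vec[of _ m m _ m])
    then show ?thesis
      using transpose_vec_mult_scalar[of "transpose_mat P" m m "C *\<^sub>v (P *\<^sub>v y)" x] m P(1) that
      by simp
  qed
  let ?f = "\<lambda>v. interleave m (P *\<^sub>v even_part m v) (P *\<^sub>v odd_part m v)"
  have Pc: "P *\<^sub>v x \<in> carrier_vec m" if "x \<in> carrier_vec m" for x
    using P(1) that by simp
  show ?thesis
  proof (rule isometricI[of _ "2 * m" _ ?f])
    show "linear_vec (2 * m) (2 * m) ?f"
      by (intro linear_vec_interleave linear_vec_mat[OF P(1)] linear_vec_even_part linear_vec_odd_part)
    fix v :: "'a vec" assume v: "v \<in> carrier_vec (2 * m)"
    show "qval (tensor_form C (pfister1 \<alpha>)) (?f v) = qval (tensor_form B (pfister1 \<alpha>)) v"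
      by (simp add: val PCP Pc)
    assume "?f v = 0\<^sub>v (2 * m)"
    then have "P *\<^sub>v even_part m v = 0\<^sub>v m" "P *\<^sub>v odd_part m v = 0\<^sub>v m"
      using interleave_eq_0D Pc by (metis parts_carrier(1,2))+
    then have "even_part m v = 0\<^sub>v m" "odd_part m v = 0\<^sub>v m"
      using invertible_mat_kernel[OF P(1,2)] by simp_all
    then show "v = 0\<^sub>v (2 * m)"
      using v by (rule parts_eq_0D)
  qed (use m in \<open>simp_all add: qdim_tensor_form\<close>)
qed

section \<open>Products of a fixed nondegenerate symmetric bilinear form with [1, \<alpha>]\<close>

locale char2_bilinear =
  fixes B :: "'a::field mat" and m :: nat
  assumes char2: "CHAR('a) = 2"
    and carrier: "B \<in> carrier_mat m m"
    and sym: "transpose_mat B = B"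
    and invertible: "invertible_mat B"
begin

definition bil :: "'a vec \<Rightarrow> 'a vec \<Rightarrow> 'a" where
  "bil x y = x \<bullet> (B *\<^sub>v y)"

lemma mult_carrier [simp]: "x \<in> carrier_vec m \<Longrightarrow> B *\<^sub>v x \<in> carrier_vec m"
  using carrier by simp

lemma bil_sym:
  assumes "x \<in> carrier_vec m" "y \<in> carrier_vec m"
  shows "bil x y = bil y x"
  using transpose_vec_mult_scalar[OF carrier assms] assms carrier
    comm_scalar_prod[of "B *\<^sub>v y" m x]
  by (simp add: sym bil_def)

lemma bil_add:
  assumes "x \<in> carrier_vec m" "y \<in> carrier_vec m" "z \<in> carrier_vec m"
  shows "bil (x + y) z = bil x z + bil y z" "bil z (x + y) = bil z x + bil z y"
  using assms carrier
  by (simp_all add: bil_def add_scalar_prod_distrib[of _ m] mult_add_distrib_mat_vec[of _ m m]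
      scalar_prod_add_distrib[of _ m])

lemma bil_smult:
  assumes "x \<in> carrier_vec m" "y \<in> carrier_vec m"
  shows "bil (c \<cdot>\<^sub>v x) y = c * bil x y" "bil x (c \<cdot>\<^sub>v y) = c * bil x y"
  using assms carrier by (simp_all add: bil_def mult_mat_vec[of _ m m])

lemmas bil_linear = bil_add bil_smult

lemma bil_nondegenerate:
  assumes x: "x \<in> carrier_vec m" and "\<And>y. y \<in> carrier_vec m \<Longrightarrow> bil x y = 0"
  shows "x = 0\<^sub>v m"
proof (rule invertible_mat_kernel[OF carrier invertible x], rule eq_vecI)
  fix i assume "i < dim_vec (0\<^sub>v m :: 'a vec)"
  then have i: "i < m" by simp
  have "0 = bil (unit_vec m i) x"
    using assms bil_sym[OF x, of "unit_vec m i"] by simp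
  also have "\<dots> = (B *\<^sub>v x) $ i"
    unfolding bil_def using i x by (intro scalar_prod_left_unit mult_carrier)
  finally show "(B *\<^sub>v x) $ i = 0\<^sub>v m $ i" using i by simp
qed (use carrier in simp)

abbreviation pf :: "'a \<Rightarrow> 'a qform" where
  "pf \<alpha> \<equiv> tensor_form B (pfister1 \<alpha>)"

lemma qdim_pf: "qdim (pf \<alpha>) = 2 * m"
  using carrier by (simp add: qdim_tensor_form)

lemma qval_pf:
  "qval (pf \<alpha>) v = bil (even_part m v) (even_part m v) + bil (even_part m v) (odd_part m v) +
    \<alpha> * bil (odd_part m v) (odd_part m v)"
  using qval_tensor_pfister1[OF char2 carrier sym] by (simp add: bil_def)

lemmas part_linear =
  linear_vecD(2,3)[OF linear_vec_even_part[of m]] linear_vecD(2,3)[OF linear_vec_odd_part[of m]]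

text \<open>The even-even and odd-odd terms occur twice and cancel. The polar form is thus
  independent of \<open>\<alpha>\<close> and pairs even parts with odd parts, so nonsingularity
  reduces to that of \<open>B\<close>.\<close>

lemma polar_pf:
  assumes "v \<in> carrier_vec (2 * m)" "w \<in> carrier_vec (2 * m)"
  shows "polar (pf \<alpha>) v w = bil (even_part m v) (odd_part m w) + bil (even_part m w) (odd_part m v)"
  using bil_sym[of "even_part m v" "even_part m w"] bil_sym[of "odd_part m v" "odd_part m w"]
  by (simp add: polar_def qval_pf part_linear assms bil_linear)
    (simp add: algebra_simps char2_simps[OF char2])

lemma even_nonsingular_pf: "pf \<alpha> \<in> even_nonsingular"
proof -
  have "quadratic_form (pf \<alpha>)"
    unfolding quadratic_form_def qdim_pf
    by (simp add: qval_pf polar_pf part_linear bil_linear power2_eq_square distrib_left mult.left_commute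
        ac_simps(1-3) add_ac)
  moreover have "nonsingular (pf \<alpha>)"
    unfolding nonsingular_def qdim_pf
  proof (intro ballI impI)
    fix v :: "'a vec"
    assume v: "v \<in> carrier_vec (2 * m)" and orth: "\<forall>w\<in>carrier_vec (2 * m). polar (pf \<alpha>) v w = 0"
    have zero: "bil x (0\<^sub>v m) = 0" "bil (0\<^sub>v m) x = 0" if "x \<in> carrier_vec m" for x
      using that bil_sym[of x "0\<^sub>v m"] by (simp_all add: bil_def)
    \<comment> \<open>A test vector with vanishing even part sees only the even part of
      \<open>v\<close>; exchanging the roles gives the odd part.\<close>
    have "bil (even_part m v) y = 0" if "y \<in> carrier_vec m" for y
      using orth[rule_format, of "interleave m (0\<^sub>v m) y"] that v by (simp add: polar_pf zero)
    then have 1: "even_part m v = 0\<^sub>v m" by (intro bil_nondegenerate) simp_all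
    have "bil (odd_part m v) y = 0" if "y \<in> carrier_vec m" for y
      using orth[rule_format, of "interleave m y (0\<^sub>v m)"] that v
      by (simp add: polar_pf zero bil_sym[of "odd_part m v" y])
    then have "odd_part m v = 0\<^sub>v m" by (intro bil_nondegenerate) simp_all
    with 1 v show "v = 0\<^sub>v (2 * m)" by (intro parts_eq_0D)
  qed
  ultimately show ?thesis by (simp add: even_nonsingular_def qdim_pf)
qed

text \<open>
  Tensored with \<open>B\<close>, this is the change of variables \<open>x + z, y, w + y, z + \<beta>(w + y)\<close> taking
  \<open>x\<^sup>2 + xy + \<alpha>y\<^sup>2 + z\<^sup>2 + zw + \<beta>w\<^sup>2\<close> to \<open>[1, \<alpha> + \<beta>] \<bottom> [0, 0]\<close>.
\<close>

lemma orth_sum_pf: "isometric (orth_sum (pf \<alpha>) (pf \<beta>)) (orth_sum (pf (\<alpha> + \<beta>)) (hyperbolic m))"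
proof -
  define k where "k = 2 * m"
  define x where "x v = even_part m (vec_first v k)" for v :: "'a vec"
  define y where "y v = odd_part m (vec_first v k)" for v :: "'a vec"
  define z where "z v = even_part m (vec_last v k)" for v :: "'a vec"
  define w where "w v = odd_part m (vec_last v k)" for v :: "'a vec"
  \<comment> \<open>\<open>B\<close> enters only the last component: the hyperbolic form uses the
    plain dot product, and \<open>B\<close> turns it into \<open>bil\<close>. Invertibility of
    \<open>B\<close> keeps the map injective.\<close>
  define f where "f v = interleave m (x v + z v) (y v) @\<^sub>v
    interleave m (w v + y v) (B *\<^sub>v (z v + \<beta> \<cdot>\<^sub>v (w v + y v)))" for v
  have car [simp]: "x v \<in> carrier_vec m" "y v \<in> carrier_vec m" "z v \<in> carrier_vec m" "w v \<in> carrier_vec m" for v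
    by (simp_all add: x_def y_def z_def w_def)
  have lin: "linear_vec (k + k) m x" "linear_vec (k + k) m y" "linear_vec (k + k) m z" "linear_vec (k + k) m w"
    unfolding x_def y_def z_def w_def k_def
    by (intro linear_vec_compose[OF linear_vec_even_part] linear_vec_compose[OF linear_vec_odd_part]
        linear_vec_first linear_vec_last)+
  show ?thesis
  proof (rule isometricI[of _ "k + k" _ f])
    show "linear_vec (k + k) (k + k) f"
      unfolding f_def[abs_def] k_def
      by (intro linear_vec_append linear_vec_interleave linear_vec_add linear_vec_mat[OF carrier]
          linear_vec_smult lin[unfolded k_def])
    fix v :: "'a vec" assume v: "v \<in> carrier_vec (k + k)"
    let ?x = "x v" and ?y = "y v" and ?z = "z v" and ?w = "w v"
    have "qval (orth_sum (pf (\<alpha> + \<beta>)) (hyperbolic m)) (f v) =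
      bil (?x + ?z) (?x + ?z) + bil (?x + ?z) ?y + (\<alpha> + \<beta>) * bil ?y ?y +
      bil (?w + ?y) (?z + \<beta> \<cdot>\<^sub>v (?w + ?y))"
      by (simp add: qval_orth_sum qdim_pf f_def qval_pf qval_hyperbolic bil_def)
    also have "\<dots> = bil ?x ?x + bil ?x ?y + \<alpha> * bil ?y ?y + (bil ?z ?z + bil ?z ?w + \<beta> * bil ?w ?w)"
      using bil_sym[of ?x ?z] bil_sym[of ?y ?z] bil_sym[of ?w ?z] bil_sym[of ?y ?w]
      by (simp add: bil_linear algebra_simps char2_simps[OF char2])
    also have "\<dots> = qval (orth_sum (pf \<alpha>) (pf \<beta>)) v"
      by (simp add: qval_orth_sum qdim_pf qval_pf x_def y_def z_def w_def k_def)
    finally show "qval (orth_sum (pf (\<alpha> + \<beta>)) (hyperbolic m)) (f v) = qval (orth_sum (pf \<alpha>) (pf \<beta>)) v" .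
    assume f0: "f v = 0\<^sub>v (k + k)"
    then have f12: "interleave m (?x + ?z) ?y = 0\<^sub>v (2 * m)"
      "interleave m (?w + ?y) (B *\<^sub>v (?z + \<beta> \<cdot>\<^sub>v (?w + ?y))) = 0\<^sub>v (2 * m)"
      unfolding f_def k_def using append_eq_0D[of _ _ "2 * m" "2 * m"] by (metis parts_carrier(3))+
    have xz: "?x + ?z = 0\<^sub>v m" and y: "?y = 0\<^sub>v m"
      using interleave_eq_0D[OF f12(1)] by simp_all
    have wy: "?w + ?y = 0\<^sub>v m" and Bz: "B *\<^sub>v (?z + \<beta> \<cdot>\<^sub>v (?w + ?y)) = 0\<^sub>v m"
      using interleave_eq_0D[OF f12(2)] by simp_all
    have w: "?w = 0\<^sub>v m" using wy y right_zero_vec[OF car(4)[of v]] by simp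
    have "\<beta> \<cdot>\<^sub>v 0\<^sub>v m = (0\<^sub>v m :: 'a vec)" by auto
    then have "B *\<^sub>v ?z = 0\<^sub>v m" using Bz wy by simp
    then have z: "?z = 0\<^sub>v m" using invertible_mat_kernel[OF carrier invertible] by simp
    have x: "?x = 0\<^sub>v m" using xz z right_zero_vec[OF car(1)[of v]] by simp
    have "vec_first v k = 0\<^sub>v k" "vec_last v k = 0\<^sub>v k"
      using parts_eq_0D x y z w unfolding x_def y_def z_def w_def k_def by (metis vec_first_carrier vec_last_carrier)+
    then show "v = 0\<^sub>v (k + k)" using v by (rule first_last_eq_0D)
  qed (simp_all add: qdim_pf k_def)
qed

section \<open>Witt classes as a homomorphic image of the additive group of F\<close>

definition pf_class :: "'a \<Rightarrow> 'a qform set" where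
  "pf_class \<alpha> = witt_class (pf \<alpha>)"

lemma pf_class_carrier: "pf_class \<alpha> \<in> carrier Iq1"
  by (simp add: pf_class_def carrier_Iq1 even_nonsingular_pf)

lemma pf_class_mult: "pf_class \<alpha> \<otimes>\<^bsub>Iq1\<^esub> pf_class \<beta> = pf_class (\<alpha> + \<beta>)"
  unfolding pf_class_def witt_class_mult[OF even_nonsingular_pf even_nonsingular_pf]
  by (rule witt_class_eq[OF witt_equiv_trans[OF witt_equivI[OF orth_sum_pf] witt_equiv_hyperbolic]])

text \<open>Since 0 + 0 = 0, this class is idempotent, and the only idempotent of a group is its
  identity.\<close>

lemma pf_class_zero: "pf_class 0 = \<one>\<^bsub>Iq1\<^esub>"
  using group.r_cancel_one[OF group_Iq1[OF char2] pf_class_carrier pf_class_carrier, of 0 0] pf_class_mult[of 0 0]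
  by simp

text \<open>Closure under inverses is automatic: a + a = 0 makes every class its own
  inverse.\<close>

lemma subgroup_pf_class:
  assumes "0 \<in> A" "\<And>a b. a \<in> A \<Longrightarrow> b \<in> A \<Longrightarrow> a + b \<in> A"
  shows "subgroup (pf_class ` A) Iq1"
proof -
  interpret group "Iq1 :: 'a qform set monoid" by (rule group_Iq1[OF char2])
  have "inv\<^bsub>Iq1\<^esub> (pf_class a) = pf_class a" for a
    by (rule inv_equality) (simp_all add: pf_class_mult pf_class_carrier pf_class_zero char2_add_self[OF char2])
  then show ?thesis
    by (intro subgroupI) (use assms pf_class_carrier in \<open>auto simp: pf_class_mult\<close>)
qed

lemma generate_pf_class:
  assumes "finite I"
  shows "generate Iq1 (pf_class ` \<alpha> ` I) = {pf_class (\<Sum>i\<in>T. \<alpha> i) | T. T \<subseteq> I}"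
proof
  interpret group "Iq1 :: 'a qform set monoid" by (rule group_Iq1[OF char2])
  let ?A = "{\<Sum>i\<in>T. \<alpha> i | T. T \<subseteq> I}"
  have eq: "{pf_class (\<Sum>i\<in>T. \<alpha> i) | T. T \<subseteq> I} = pf_class ` ?A" by blast
  have "subgroup (pf_class ` ?A) Iq1"
  proof (rule subgroup_pf_class)
    show "0 \<in> ?A" by (auto intro!: exI[of _ "{}"])
    fix a b assume "a \<in> ?A" "b \<in> ?A"
    then obtain T U where T: "a = sum \<alpha> T" "T \<subseteq> I" and U: "b = sum \<alpha> U" "U \<subseteq> I" by blast
    have fin: "finite T" "finite U" using T U assms finite_subset by blast+
    \<comment> \<open>The terms over the intersection occur twice and cancel, so subset sums add by
      symmetric difference of their index sets.\<close>
    have "a + b = sum \<alpha> (T - U) + sum \<alpha> (U - T)"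
      using sum.Int_Diff[OF fin(1), of \<alpha> U] sum.Int_Diff[OF fin(2), of \<alpha> T]
      by (simp add: T U Int_commute char2_simps[OF char2] ac_simps)
    also have "\<dots> = sum \<alpha> ((T - U) \<union> (U - T))"
      using fin by (subst sum.union_disjoint) auto
    finally show "a + b \<in> ?A" using T U by blast
  qed
  moreover have "pf_class ` \<alpha> ` I \<subseteq> pf_class ` ?A"
    by (auto intro!: imageI exI[of _ "{i}" for i])
  ultimately show "generate Iq1 (pf_class ` \<alpha> ` I) \<subseteq> {pf_class (\<Sum>i\<in>T. \<alpha> i) | T. T \<subseteq> I}"
    unfolding eq by (intro generate_subgroup_incl)
  have "pf_class (\<Sum>i\<in>T. \<alpha> i) \<in> generate Iq1 (pf_class ` \<alpha> ` I)" if "T \<subseteq> I" for T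
    using finite_subset[OF that assms] that
  proof (induction T rule: finite_induct)
    case empty
    then show ?case by (simp add: pf_class_zero generate.one)
  next
    case (insert i T)
    then have "pf_class (\<alpha> i) \<otimes>\<^bsub>Iq1\<^esub> pf_class (\<Sum>i\<in>T. \<alpha> i) \<in> generate Iq1 (pf_class ` \<alpha> ` I)"
      by (intro generate.eng[OF generate.incl]) auto
    then show ?case using insert by (simp add: pf_class_mult)
  qed
  then show "{pf_class (\<Sum>i\<in>T. \<alpha> i) | T. T \<subseteq> I} \<subseteq> generate Iq1 (pf_class ` \<alpha> ` I)" by blast
qed

end

section \<open>Pfister forms\<close>

text \<open>The lexicographic basis order makes the diagonal factor act on whole blocks. Transposes
  and determinants of Pfister forms then follow from block matrix rules.\<close>

lemma bil_tensor_diag_four_block: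
  fixes C :: "'a::field mat"
  assumes C: "C \<in> carrier_mat m m"
  shows "bil_tensor (mat_diag 2 (\<lambda>i. if i = 0 then 1 else \<beta>)) C =
    four_block_mat C (0\<^sub>m m m) (0\<^sub>m m m) (\<beta> \<cdot>\<^sub>m C)"
proof (rule eq_matI)
  fix i j assume "i < dim_row (four_block_mat C (0\<^sub>m m m) (0\<^sub>m m m) (\<beta> \<cdot>\<^sub>m C))"
    "j < dim_col (four_block_mat C (0\<^sub>m m m) (0\<^sub>m m m) (\<beta> \<cdot>\<^sub>m C))"
  then have ij: "i < 2 * m" "j < 2 * m" using C by auto
  have div: "k div m = (if k < m then 0 else 1)" "k mod m = (if k < m then k else k - m)"
    if "k < 2 * m" for k
    using that by (auto simp: div_if mod_if)
  show "bil_tensor (mat_diag 2 (\<lambda>i. if i = 0 then 1 else \<beta>)) C $$ (i, j) =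
    four_block_mat C (0\<^sub>m m m) (0\<^sub>m m m) (\<beta> \<cdot>\<^sub>m C) $$ (i, j)"
    using C ij by (auto simp: bil_tensor_def mat_diag_def div[OF ij(1)] div[OF ij(2)])
qed (use C in \<open>auto simp: bil_tensor_def mat_diag_def\<close>)

text \<open>Invertibility is carried through the recursion as a nonzero determinant, which is
  multiplicative on block diagonal matrices; \<open>\<beta> \<noteq> 0\<close> keeps the second
  block nondegenerate.\<close>

lemma bil_pfister_form_bilinear:
  fixes \<beta>s :: "'a::field list"
  assumes char2: "CHAR('a) = 2" and "0 \<notin> set \<beta>s"
  shows "char2_bilinear (bil_pfister_form \<beta>s) (2 ^ length \<beta>s)"
proof -
  have "bil_pfister_form \<beta>s \<in> carrier_mat (2 ^ length \<beta>s) (2 ^ length \<beta>s) \<and>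
    transpose_mat (bil_pfister_form \<beta>s) = bil_pfister_form \<beta>s \<and> det (bil_pfister_form \<beta>s) \<noteq> 0"
    using assms(2)
  proof (induction \<beta>s)
    case (Cons \<beta> \<beta>s)
    define m C where "m = (2::nat) ^ length \<beta>s" and "C = bil_pfister_form \<beta>s"
    have C: "C \<in> carrier_mat m m" "transpose_mat C = C" "det C \<noteq> 0"
      using Cons by (simp_all add: m_def C_def)
    have bC: "\<beta> \<cdot>\<^sub>m C \<in> carrier_mat m m" using C(1) by simp
    have *: "bil_pfister_form (\<beta> # \<beta>s) = four_block_mat C (0\<^sub>m m m) (0\<^sub>m m m) (\<beta> \<cdot>\<^sub>m C)"
      using bil_tensor_diag_four_block[OF C(1)] by (simp add: C_def)
    have "four_block_mat C (0\<^sub>m m m) (0\<^sub>m m m) (\<beta> \<cdot>\<^sub>m C) \<in> carrier_mat (m + m) (m + m)"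
      using four_block_carrier_mat[OF C(1) bC] .
    moreover have "transpose_mat (\<beta> \<cdot>\<^sub>m C) = \<beta> \<cdot>\<^sub>m transpose_mat C"
      by (rule eq_matI) auto
    then have "transpose_mat (four_block_mat C (0\<^sub>m m m) (0\<^sub>m m m) (\<beta> \<cdot>\<^sub>m C)) =
        four_block_mat C (0\<^sub>m m m) (0\<^sub>m m m) (\<beta> \<cdot>\<^sub>m C)"
      using C(2) by (subst transpose_four_block_mat[OF C(1) _ _ bC]) auto
    moreover have "det (four_block_mat C (0\<^sub>m m m) (0\<^sub>m m m) (\<beta> \<cdot>\<^sub>m C)) = det C * det (\<beta> \<cdot>\<^sub>m C)"
      by (rule det_four_block_mat_upper_right_zero[OF C(1) refl _ bC]) simp
    ultimately show ?case
      unfolding * using C Cons.prems by (simp add: m_def mult_2)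
  qed simp
  then show ?thesis
    using det_0_iff_vec_prod_zero_field[of "bil_pfister_form \<beta>s" "2 ^ length \<beta>s"]
    by unfold_locales (blast intro: char2 invertible_matI)+
qed

section \<open>Generating subgroups in I_q^n and in I_q^1\<close>

lemma isometric_scale_form: "isometric \<phi> \<psi> \<Longrightarrow> isometric (scale_form c \<phi>) (scale_form c \<psi>)"
  by (fastforce simp: isometric_def scale_form_def)

lemma even_nonsingular_scale_form:
  fixes \<phi> :: "'a::field qform"
  assumes "\<phi> \<in> even_nonsingular" "c \<noteq> 0"
  shows "scale_form c \<phi> \<in> even_nonsingular"
proof -
  have "polar (scale_form c \<phi>) v w = c * polar \<phi> v w" for v w
    by (simp add: polar_def scale_form_def algebra_simps)
  then show ?thesis
    using assms
    by (auto simp: even_nonsingular_def quadratic_form_def nonsingular_def scale_form_def algebra_simps)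
qed

text \<open>The generators must be classes of nonsingular forms. A Pfister form has the same class
  as its explicit model, and scaling by \<open>c \<noteq> 0\<close> preserves
  nonsingularity.\<close>

lemma subgroup_Iq:
  assumes char2: "CHAR('a::field) = 2"
  shows "subgroup (generate Iq1 {witt_class (scale_form c \<phi>) | c (\<phi> :: 'a qform). c \<noteq> 0 \<and> quad_pfister n \<phi>}) Iq1"
proof (rule group.generate_is_subgroup[OF group_Iq1[OF char2]], safe)
  fix c :: 'a and \<phi> :: "'a qform" assume c: "c \<noteq> 0" and "quad_pfister n \<phi>"
  then obtain \<beta>s \<alpha> where \<beta>s: "0 \<notin> set \<beta>s" "isometric \<phi> (tensor_form (bil_pfister_form \<beta>s) (pfister1 \<alpha>))"
    unfolding quad_pfister_def by blast
  interpret char2_bilinear "bil_pfister_form \<beta>s" "2 ^ length \<beta>s"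
    by (rule bil_pfister_form_bilinear[OF char2 \<beta>s(1)])
  have "witt_class (scale_form c \<phi>) = witt_class (scale_form c (pf \<alpha>))"
    by (rule witt_class_eq[OF witt_equivI[OF isometric_scale_form[OF \<beta>s(2)]]])
  then show "witt_class (scale_form c \<phi>) \<in> carrier Iq1"
    using even_nonsingular_scale_form[OF even_nonsingular_pf c] by (simp add: carrier_Iq1)
qed

text \<open>The classes of \<open>S\<close> are among the generators of I_q^n, with scalar 1, and
  generating inside a subgroup agrees with generating in the ambient group.\<close>

lemma generated_group_eq:
  fixes S :: "'a::field qform set"
  assumes char2: "CHAR('a) = 2" and S: "\<And>\<phi>. \<phi> \<in> S \<Longrightarrow> quad_pfister n \<phi>"
  shows "generated_group n S = generate Iq1 (witt_class ` S)"
proof -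
  let ?G = "{witt_class (scale_form c \<phi>) | c (\<phi> :: 'a qform). c \<noteq> 0 \<and> quad_pfister n \<phi>}"
  have "witt_class \<phi> \<in> ?G" if "\<phi> \<in> S" for \<phi>
  proof -
    have "scale_form 1 \<phi> = \<phi>" by (cases \<phi>) (simp add: scale_form_def)
    then show ?thesis using S[OF that] by (metis (mono_tags, lifting) mem_Collect_eq one_neq_zero)
  qed
  then have "witt_class ` S \<subseteq> generate Iq1 ?G"
    by (auto intro: generate.incl)
  then show ?thesis
    unfolding generated_group_def Iq_def
    by (rule group.generate_consistent[OF group_Iq1[OF char2] _ subgroup_Iq[OF char2]])
qed

lemma bil_isometric_refl: "B \<in> carrier_mat m m \<Longrightarrow> bil_isometric B B"
  unfolding bil_isometric_def
  by (intro exI[of _ m] conjI bexI[of _ "1\<^sub>m m"]) (auto intro: invertible_matI[of _ m])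

theorem proposition3p6:
  fixes n :: nat and S :: "'a::field qform set"
  assumes "CHAR('a) = 2" and "n \<ge> 1" and "left_linked n S"
  shows "strongly_tight n S \<and>
    (finite (witt_class ` S) \<longrightarrow>
      (\<exists>(B :: 'a mat) (s :: nat) (\<alpha> :: nat \<Rightarrow> 'a). bil_pfister (n - 1) B \<and>
         generated_group n S =
           {witt_class (tensor_form B (pfister1 (\<Sum>i\<in>T. \<alpha> i))) | T. T \<subseteq> {1..s}}))"
proof -
  note char2 = assms(1)
  from assms(3) obtain C where S: "\<And>\<phi>. \<phi> \<in> S \<Longrightarrow> quad_pfister n \<phi>" and C: "bil_pfister (n - 1) C"
    and SC: "\<And>\<phi>. \<phi> \<in> S \<Longrightarrow> \<exists>\<alpha>. isometric \<phi> (tensor_form C (pfister1 \<alpha>))"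
    unfolding left_linked_def by blast
  from C obtain \<beta>s where \<beta>s: "length \<beta>s = n - 1" "0 \<notin> set \<beta>s" "bil_isometric C (bil_pfister_form \<beta>s)"
    unfolding bil_pfister_def by blast
  \<comment> \<open>The linking form \<open>C\<close> is only isometric to a standard Pfister form.
    Passing to the standard Gram matrix gives symmetry and invertibility and leaves the Witt classes
    unchanged.\<close>
  define B where "B = bil_pfister_form \<beta>s"
  interpret char2_bilinear B "2 ^ length \<beta>s"
    unfolding B_def by (rule bil_pfister_form_bilinear[OF char2 \<beta>s(2)])
  have B: "bil_pfister (n - 1) B"
    using \<beta>s(1,2) bil_isometric_refl[OF carrier] unfolding bil_pfister_def B_def by blast
  have gen: "generated_group n S = generate Iq1 (witt_class ` S)"
    using char2 S by (rule generated_group_eq)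
  \<comment> \<open>Since \<open>n - 1\<close> is truncated subtraction, \<open>n \<ge> 1\<close> is
    what gives \<open>length \<beta>s + 1 = n\<close>.\<close>
  have pfister: "quad_pfister n (pf \<alpha>)" for \<alpha>
    unfolding quad_pfister_def B_def using \<beta>s(1,2) assms(2)
    by (intro exI[of _ \<beta>s] exI[of _ \<alpha>]) simp
  have range: "witt_class ` S \<subseteq> range pf_class"
  proof
    fix X assume "X \<in> witt_class ` S"
    then obtain \<phi> \<alpha> where "X = witt_class \<phi>" "isometric \<phi> (tensor_form C (pfister1 \<alpha>))"
      using SC by blast
    then have "X = pf_class \<alpha>"
      using tensor_form_bil_isometric[OF char2 \<beta>s(3)[folded B_def] sym, of \<alpha>]
      unfolding pf_class_def by (metis isometric_trans witt_class_eq witt_equivI)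
    then show "X \<in> range pf_class" by blast
  qed
  \<comment> \<open>The image of all of F is a subgroup containing the classes of \<open>S\<close>,
    so tightness holds for infinite \<open>S\<close> as well.\<close>
  have "generated_group n S \<subseteq> range pf_class"
    unfolding gen
    by (rule group.generate_subgroup_incl[OF group_Iq1[OF char2] range subgroup_pf_class]) simp_all
  then have "strongly_tight n S"
    using S pfister unfolding strongly_tight_def pf_class_def by blast
  \<comment> \<open>Finitely many parameters describe a finite group, hence the condition on the
    classes. \<open>S\<close> itself may still be infinite, as a class has many
    representatives.\<close>
  moreover have "\<exists>s \<alpha>. generated_group n S = {witt_class (pf (\<Sum>i\<in>T. \<alpha> i)) | T. T \<subseteq> {1..s::nat}}"
    if fin: "finite (witt_class ` S)"
  proof -
    \<comment> \<open>Different parameters may give the same class, so finiteness of the classes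
      yields some finite set of parameters, which is then enumerated from 1.\<close>
    obtain A where A: "finite A" "witt_class ` S = pf_class ` A"
      using finite_subset_image[OF fin range] by blast
    obtain \<alpha> where "bij_betw \<alpha> {1..card A} A"
      using ex_bij_betw_nat_finite_1[OF A(1)] by blast
    then have "A = \<alpha> ` {1..card A}" by (simp add: bij_betw_def)
    then have "generated_group n S = {pf_class (\<Sum>i\<in>T. \<alpha> i) | T. T \<subseteq> {1..card A}}"
      unfolding gen A(2) using generate_pf_class[of "{1..card A}" \<alpha>] by simp
    then show ?thesis unfolding pf_class_def by blast
  qed
  ultimately show ?thesis using B by blast
qed

end
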